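(* Let $h_d,h_{b,u},h_{b,d_1},h_{b,d_2},h_{d_1,u},h_{d_2,u},\eta_1,\eta_2,\sigma^2,B_0>0$, $P_{1,M},P_{2,M}>0$ and $0<P_{u,m}<P_{u,M}$. Let $\mathcal{F}$ be the set of $(P_1,P_2,P_u)\in[0,P_{1,M}]\times[0,P_{2,M}]\times[P_{u,m},P_{u,M}]$ satisfying $P_uh_{d_1,u}\ge P_2h_d+P_1\eta_1$, $P_uh_{d_2,u}\ge P_1h_d+P_2\eta_2$, and either - (first decoding order) $P_uh_{b,u}\le P_2h_{b,d_2}-P_1h_{b,d_1}$ and $P_uh_{b,u}\le P_1h_{b,d_1}$, or - (second decoding order) $P_uh_{b,u}\le P_1h_{b,d_1}-P_2h_{b,d_2}$ and $P_uh_{b,u}\le P_2h_{b,d_2}$, where one decoding order is fixed throughout. Assume $\mathcal{F}\neq\emptyset$, and let $$R_{D2D}(P_1,P_2)=B_0\log_2\Big(1+\frac{P_1h_d}{P_2\eta_2+\sigma^2}\Big)+B_0\log_2\Big(1+\frac{P_2h_d}{P_1\eta_1+\sigma^2}\Big).$$ Let $\mathcal{D}$ be the projection of $\mathcal{F}$ on the $(P_1,P_2)$ plane, and consider the (possibly empty or degenerate) segments $$E_1=\{(P_1,P_2)\in\mathcal{D}:P_1=P_{1,M}\},\qquad E_2=\{(P_1,P_2)\in\mathcal{D}:P_2=P_{2,M}\},$$ $$E_{U,2}=\Big\{(P_1,P_2)\in\mathcal{D}:\tfrac{P_2h_d+P_1\eta_1}{h_{d_1,u}}=P_{u,M}\Big\},\qquad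 E_{U,4}=\Big\{(P_1,P_2)\in\mathcal{D}:\tfrac{P_1h_d+P_2\eta_2}{h_{d_2,u}}=P_{u,M}\Big\}.$$ Put $$A=-(\eta_1\eta_2-h_d^2)\eta_1^2\eta_2,\quad B=2\eta_1^2\eta_2(P_{u,M}h_{d_1,u}\eta_2+\sigma^2h_d),$$ $$C=-P_{u,M}^2h_{d_1,u}^2\eta_2^2\eta_1+P_{u,M}\sigma^2h_dh_{d_1,u}\eta_2(h_d-2\eta_1)+\sigma^4h_d^2(h_d-\eta_1),$$ $$A'=(\eta_1\eta_2-h_d^2)\eta_1,\quad B'=2\eta_1(P_{u,M}h_{d_2,u}h_d+\sigma^2\eta_2),$$ $$C'=-P_{u,M}^2h_{d_2,u}^2\eta_1-\sigma^2\eta_1h_{d_2,u}P_{u,M}+\sigma^4(\eta_2-h_d),$$ and, when these are defined real numbers, $$sol_1=\frac{-B-\sqrt{B^2-4AC}}{2A},\qquad sol_1'=\frac{-B'-\sqrt{B'^2-4A'C'}}{2A'}.$$ Then: (i) On each of $E_1$ and $E_2$ (when non-empty), the maximum of $R_{D2D}$ is attained at an endpoint of the segment. (ii) On $E_{U,2}$ (when non-empty), the maximum of $R_{D2D}$ is attained at an endpoint, or at the point of $E_{U,2}$ with $P_1=sol_1$ (when $sol_1$ is defined and such a point exists). (iii) On $E_{U,4}$ (when non-empty), the maximum of $R_{D2D}$ is attained at an endpoint, or at the point of $E_{U,4}$ with $P_1=sol_1'$ (when $sol_1'$ is defined and such a point exists). (iv) The maximum of $R_{D2D}$ over $\mathcal{F}$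 is attained at one of the endpoints of $E_1,E_2,E_{U,2},E_{U,4}$ or at one of the points with $P_1=sol_1$ on $E_{U,2}$ or $P_1=sol_1'$ on $E_{U,4}$. This list contains at most seven distinct points $(P_1,P_2)$. In particular, the problem is solved exactly with a number of arithmetic operations, comparisons, square roots and evaluations of $R_{D2D}$ bounded by an absolute constant.
   Context: This is the full-duplex D2D sum-rate maximization with mutual successive interference cancellation. $P_1,P_2$ are the transmit powers of the two D2D devices $d_1,d_2$ and $P_u$ that of the cellular user $u$; $P_{1,M},P_{2,M},P_{u,M}$ are the power limits and $P_{u,m}$ the minimum power of $u$ ensuring its target rate. $\mathcal{F}$ is defined by the power limits and the power multiplexing conditions of the decoding order chosen at the base station. $B_0$ is the channel bandwidth, $\sigma^2$ the noise power, the $h$'s are channel gains, and $\eta_1,\eta_2$ are self-interference factors. $R_{D2D}$ does not depend on $P_u$; for a given $(P_1,P_2)$ in the projection, $P_u$ is taken to be the smallest admissible value $\max\{(P_2h_d+P_1\eta_1)/h_{d_1,u},\,(P_1h_d+P_2\eta_2)/h_{d_2,u},\,P_{u,m}\}$. *)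

theory Defs
  imports "HOL-Analysis.Analysis"
begin

section \<open>The full-duplex D2D sum-rate maximization problem\<close>

text \<open>The field \<open>sigma2\<close> is the noise power itself (written \<open>\<sigma>\<^sup>2\<close> in the literature), so \<open>\<sigma>\<^sup>4\<close> becomes
  \<open>sigma2\<^sup>2\<close>.  Indices \<open>b\<close>, \<open>u\<close>, \<open>d1\<close>, \<open>d2\<close> denote the base station, the cellular user and the
  two D2D devices; \<open>Pum\<close>, \<open>PuM\<close> are the lower and upper limits on the power of \<open>u\<close>.\<close>

record d2d =
  h_d :: real
  h_bu :: real
  h_bd1 :: real
  h_bd2 :: real
  h_d1u :: real
  h_d2u :: real
  eta1 :: real
  eta2 :: real
  sigma2 :: real
  B0 :: real
  P1M :: real
  P2M :: real
  Pum :: real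
  PuM :: real

definition admissible :: "d2d \<Rightarrow> bool" where
  "admissible c \<longleftrightarrow>
     h_d c > 0 \<and> h_bu c > 0 \<and> h_bd1 c > 0 \<and> h_bd2 c > 0 \<and> h_d1u c > 0 \<and> h_d2u c > 0 \<and>
     eta1 c > 0 \<and> eta2 c > 0 \<and> sigma2 c > 0 \<and> B0 c > 0 \<and>
     P1M c > 0 \<and> P2M c > 0 \<and> 0 < Pum c \<and> Pum c < PuM c"

datatype decoding_order = First | Second

fun decodable :: "decoding_order \<Rightarrow> d2d \<Rightarrow> real \<Rightarrow> real \<Rightarrow> real \<Rightarrow> bool" where
  "decodable First c P1 P2 Pu \<longleftrightarrow>
     Pu * h_bu c \<le> P2 * h_bd2 c - P1 * h_bd1 c \<and> Pu * h_bu c \<le> P1 * h_bd1 c"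
| "decodable Second c P1 P2 Pu \<longleftrightarrow>
     Pu * h_bu c \<le> P1 * h_bd1 c - P2 * h_bd2 c \<and> Pu * h_bu c \<le> P2 * h_bd2 c"

definition feasible :: "decoding_order \<Rightarrow> d2d \<Rightarrow> (real \<times> real \<times> real) set" where
  "feasible ord c = {(P1, P2, Pu).
     P1 \<in> {0..P1M c} \<and> P2 \<in> {0..P2M c} \<and> Pu \<in> {Pum c..PuM c} \<and>
     Pu * h_d1u c \<ge> P2 * h_d c + P1 * eta1 c \<and>
     Pu * h_d2u c \<ge> P1 * h_d c + P2 * eta2 c \<and>
     decodable ord c P1 P2 Pu}"

definition rate :: "d2d \<Rightarrow> real \<times> real \<Rightarrow> real" where
  "rate c = (\<lambda>(P1, P2).
     B0 c * log 2 (1 + P1 * h_d c / (P2 * eta2 c + sigma2 c)) +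
     B0 c * log 2 (1 + P2 * h_d c / (P1 * eta1 c + sigma2 c)))"

definition objective :: "d2d \<Rightarrow> real \<times> real \<times> real \<Rightarrow> real" where
  "objective c = (\<lambda>(P1, P2, Pu). rate c (P1, P2))"

definition projD :: "decoding_order \<Rightarrow> d2d \<Rightarrow> (real \<times> real) set" where
  "projD ord c = (\<lambda>(P1, P2, Pu). (P1, P2)) ` feasible ord c"

definition Pu_min :: "d2d \<Rightarrow> real \<Rightarrow> real \<Rightarrow> real" where
  "Pu_min c P1 P2 =
     Max {(P2 * h_d c + P1 * eta1 c) / h_d1u c, (P1 * h_d c + P2 * eta2 c) / h_d2u c, Pum c}"

lemma Pu_min_least:
  assumes "admissible c" "(P1, P2) \<in> projD ord c"
  shows "(P1, P2, Pu_min c P1 P2) \<in> feasible ord c"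
    and "\<And>Pu. (P1, P2, Pu) \<in> feasible ord c \<Longrightarrow> Pu_min c P1 P2 \<le> Pu"
proof -
  have pos: "h_d1u c > 0" "h_d2u c > 0" "h_bu c > 0"
    using assms(1) by (auto simp: admissible_def)
  show least: "Pu_min c P1 P2 \<le> Pu" if "(P1, P2, Pu) \<in> feasible ord c" for Pu
    using that pos by (auto simp: Pu_min_def feasible_def pos_divide_le_eq)
  obtain Pu where Pu: "(P1, P2, Pu) \<in> feasible ord c"
    using assms(2) by (auto simp: projD_def)
  let ?m = "Pu_min c P1 P2"
  have le: "?m \<le> Pu" by (rule least[OF Pu])
  then have "?m * h_bu c \<le> Pu * h_bu c"
    using pos by simp
  then have dec: "decodable ord c P1 P2 ?m"
    using Pu by (cases ord) (auto simp: feasible_def)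
  have "(P2 * h_d c + P1 * eta1 c) / h_d1u c \<le> ?m" "(P1 * h_d c + P2 * eta2 c) / h_d2u c \<le> ?m"
    "Pum c \<le> ?m"
    by (simp_all add: Pu_min_def)
  then show "(P1, P2, ?m) \<in> feasible ord c"
    using Pu le dec pos by (simp add: feasible_def pos_divide_le_eq)
qed

definition E1 :: "decoding_order \<Rightarrow> d2d \<Rightarrow> (real \<times> real) set" where
  "E1 ord c = {(P1, P2) \<in> projD ord c. P1 = P1M c}"

definition E2 :: "decoding_order \<Rightarrow> d2d \<Rightarrow> (real \<times> real) set" where
  "E2 ord c = {(P1, P2) \<in> projD ord c. P2 = P2M c}"

definition EU2 :: "decoding_order \<Rightarrow> d2d \<Rightarrow> (real \<times> real) set" where
  "EU2 ord c = {(P1, P2) \<in> projD ord c. (P2 * h_d c + P1 * eta1 c) / h_d1u c = PuM c}"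

definition EU4 :: "decoding_order \<Rightarrow> d2d \<Rightarrow> (real \<times> real) set" where
  "EU4 ord c = {(P1, P2) \<in> projD ord c. (P1 * h_d c + P2 * eta2 c) / h_d2u c = PuM c}"

text \<open>A set that is not a (possibly degenerate) nonempty segment has no endpoints.\<close>

definition is_segment :: "'a::real_vector set \<Rightarrow> bool" where
  "is_segment S \<longleftrightarrow> (\<exists>a b. S = closed_segment a b)"

definition endpoints :: "'a::real_vector set \<Rightarrow> 'a set" where
  "endpoints S = {a. \<exists>b. S = closed_segment a b}"

definition coeffA :: "d2d \<Rightarrow> real" where
  "coeffA c = - (eta1 c * eta2 c - (h_d c)\<^sup>2) * (eta1 c)\<^sup>2 * eta2 c"

definition coeffB :: "d2d \<Rightarrow> real" where
  "coeffB c = 2 * (eta1 c)\<^sup>2 * eta2 c * (PuM c * h_d1u c * eta2 c + sigma2 c * h_d c)"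

definition coeffC :: "d2d \<Rightarrow> real" where
  "coeffC c = - (PuM c)\<^sup>2 * (h_d1u c)\<^sup>2 * (eta2 c)\<^sup>2 * eta1 c
     + PuM c * sigma2 c * h_d c * h_d1u c * eta2 c * (h_d c - 2 * eta1 c)
     + (sigma2 c)\<^sup>2 * (h_d c)\<^sup>2 * (h_d c - eta1 c)"

definition coeffA' :: "d2d \<Rightarrow> real" where
  "coeffA' c = (eta1 c * eta2 c - (h_d c)\<^sup>2) * eta1 c"

definition coeffB' :: "d2d \<Rightarrow> real" where
  "coeffB' c = 2 * eta1 c * (PuM c * h_d2u c * h_d c + sigma2 c * eta2 c)"

definition coeffC' :: "d2d \<Rightarrow> real" where
  "coeffC' c = - (PuM c)\<^sup>2 * (h_d2u c)\<^sup>2 * eta1 c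
     - sigma2 c * eta1 c * h_d2u c * PuM c
     + (sigma2 c)\<^sup>2 * (eta2 c - h_d c)"

text \<open>\<open>is_sol A B C x\<close>: the number \<open>(- B - sqrt (B\<^sup>2 - 4 A C)) / (2 A)\<close> is defined over the reals and
  equals \<open>x\<close>.  The guards are needed since \<open>/\<close> and \<open>sqrt\<close> are total functions in HOL.\<close>

definition is_sol :: "real \<Rightarrow> real \<Rightarrow> real \<Rightarrow> real \<Rightarrow> bool" where
  "is_sol A B C x \<longleftrightarrow>
     A \<noteq> 0 \<and> B\<^sup>2 - 4 * A * C \<ge> 0 \<and> x = (- B - sqrt (B\<^sup>2 - 4 * A * C)) / (2 * A)"

definition sol1_points :: "decoding_order \<Rightarrow> d2d \<Rightarrow> (real \<times> real) set" where
  "sol1_points ord c = {(P1, P2) \<in> EU2 ord c. is_sol (coeffA c) (coeffB c) (coeffC c) P1}"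

definition sol1'_points :: "decoding_order \<Rightarrow> d2d \<Rightarrow> (real \<times> real) set" where
  "sol1'_points ord c = {(P1, P2) \<in> EU4 ord c. is_sol (coeffA' c) (coeffB' c) (coeffC' c) P1}"

definition candidates :: "decoding_order \<Rightarrow> d2d \<Rightarrow> (real \<times> real) set" where
  "candidates ord c =
     endpoints (E1 ord c) \<union> endpoints (E2 ord c) \<union> endpoints (EU2 ord c) \<union> endpoints (EU4 ord c)
     \<union> sol1_points ord c \<union> sol1'_points ord c"


section \<open>Computation model\<close>

text \<open>Algebraic computation trees over the reals, extended by square roots and calls to an oracle
  \<open>r\<close> for the objective.  The memory is a list of reals, initially the problem data; each
  instruction appends its result.  Execution fails (\<open>None\<close>) on an unused memory address, a division
  by zero, the square root of a negative number, or an oracle call at a negative power.\<close>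

datatype instr =
    Lit int
  | Add nat nat
  | Sub nat nat
  | Mul nat nat
  | Div nat nat
  | Sqrt nat
  | Rate nat nat

datatype ctree =
    Output nat nat nat
  | Do instr ctree
  | IfLe nat nat ctree ctree

fun legal :: "real list \<Rightarrow> instr \<Rightarrow> bool" where
  "legal xs (Lit z) \<longleftrightarrow> True"
| "legal xs (Add i j) \<longleftrightarrow> i < length xs \<and> j < length xs"
| "legal xs (Sub i j) \<longleftrightarrow> i < length xs \<and> j < length xs"
| "legal xs (Mul i j) \<longleftrightarrow> i < length xs \<and> j < length xs"
| "legal xs (Div i j) \<longleftrightarrow> i < length xs \<and> j < length xs \<and> xs ! j \<noteq> 0"
| "legal xs (Sqrt i) \<longleftrightarrow> i < length xs \<and> xs ! i \<ge> 0"
| "legal xs (Rate i j) \<longleftrightarrow> i < length xs \<and> j < length xs \<and> xs ! i \<ge> 0 \<and> xs ! j \<ge> 0"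

fun result :: "(real \<times> real \<Rightarrow> real) \<Rightarrow> real list \<Rightarrow> instr \<Rightarrow> real" where
  "result r xs (Lit z) = of_int z"
| "result r xs (Add i j) = xs ! i + xs ! j"
| "result r xs (Sub i j) = xs ! i - xs ! j"
| "result r xs (Mul i j) = xs ! i * xs ! j"
| "result r xs (Div i j) = xs ! i / xs ! j"
| "result r xs (Sqrt i) = sqrt (xs ! i)"
| "result r xs (Rate i j) = r (xs ! i, xs ! j)"

text \<open>The second component of the value is the number of instructions and comparisons executed.\<close>

fun exec :: "(real \<times> real \<Rightarrow> real) \<Rightarrow> ctree \<Rightarrow> real list \<Rightarrow> ((real \<times> real \<times> real) \<times> nat) option" where
  "exec r (Output i j k) xs =
     (if i < length xs \<and> j < length xs \<and> k < length xs
      then Some ((xs ! i, xs ! j, xs ! k), 0) else None)"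
| "exec r (Do s t) xs =
     (if legal xs s
      then map_option (apsnd Suc) (exec r t (xs @ [result r xs s])) else None)"
| "exec r (IfLe i j t t') xs =
     (if i < length xs \<and> j < length xs
      then map_option (apsnd Suc) (exec r (if xs ! i \<le> xs ! j then t else t') xs) else None)"

definition inputs :: "d2d \<Rightarrow> real list" where
  "inputs c = [h_d c, h_bu c, h_bd1 c, h_bd2 c, h_d1u c, h_d2u c, eta1 c, eta2 c, sigma2 c, B0 c,
     P1M c, P2M c, Pum c, PuM c]"

end

theory Submission
  imports Defs
begin

text \<open>
  The projection of the feasible set is a polygon, cut out by four halfplanes with positive bounds
  (the power limits) and six whose bounds are nonpositive (the decoding conditions at the smallest
  admissible \<open>P\<^sub>u\<close>).  Scaling a point up preserves the latter and increases the rate, so the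
  maximum lies on one of the four faces \<open>E\<^sub>1\<close>, \<open>E\<^sub>2\<close>, \<open>E\<^bsub>U,2\<^esub>\<close>, \<open>E\<^bsub>U,4\<^esub>\<close>.

  On each face the rate is quasiconvex, so its maximum is attained at an endpoint; the stationary
  points \<open>sol\<^sub>1\<close> and \<open>sol\<^sub>1'\<close> are never needed.

  The faces form a chain meeting each ray from the origin at most once.  Ordered by slope, every
  endpoint but the first is the last point of some face, which leaves at most five endpoints.

  Every endpoint is an intersection of the line of its face with another bounding line.  A
  computation tree can therefore compute these finitely many intersections, discard those outside
  the polygon, and compare the rates at the others.
\<close>

section \<open>The polygon of feasible power pairs\<close>

type_synonym halfplane = "(d2d \<Rightarrow> real) \<times> (d2d \<Rightarrow> real) \<times> (d2d \<Rightarrow> real)"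

definition lhs :: "halfplane \<Rightarrow> d2d \<Rightarrow> real \<times> real \<Rightarrow> real" where
  "lhs H c p = fst H c * fst p + fst (snd H) c * snd p"

definition rhs :: "halfplane \<Rightarrow> d2d \<Rightarrow> real" where
  "rhs H = snd (snd H)"

definition upper :: "halfplane list" where
  "upper = [(\<lambda>c. 1, \<lambda>c. 0, P1M), (\<lambda>c. 0, \<lambda>c. 1, P2M),
     (eta1, h_d, \<lambda>c. PuM c * h_d1u c), (h_d, eta2, \<lambda>c. PuM c * h_d2u c)]"

text \<open>The received powers that have to dominate \<open>P\<^sub>u h\<^sub>b\<^sub>u\<close>, as linear forms in \<open>(P\<^sub>1, P\<^sub>2)\<close>.\<close>

fun margins :: "decoding_order \<Rightarrow> ((d2d \<Rightarrow> real) \<times> (d2d \<Rightarrow> real)) list" where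
  "margins First = [(\<lambda>c. - h_bd1 c, h_bd2), (h_bd1, \<lambda>c. 0)]"
| "margins Second = [(h_bd1, \<lambda>c. - h_bd2 c), (\<lambda>c. 0, h_bd2)]"

text \<open>The decoding conditions at the smallest admissible \<open>P\<^sub>u\<close>, one halfplane for each margin and
  each of the three terms of the maximum.\<close>

definition lower_of :: "(d2d \<Rightarrow> real) \<times> (d2d \<Rightarrow> real) \<Rightarrow> halfplane list" where
  "lower_of = (\<lambda>(a, b).
     [(\<lambda>c. eta1 c * h_bu c - h_d1u c * a c, \<lambda>c. h_d c * h_bu c - h_d1u c * b c, \<lambda>c. 0),
      (\<lambda>c. h_d c * h_bu c - h_d2u c * a c, \<lambda>c. eta2 c * h_bu c - h_d2u c * b c, \<lambda>c. 0),
      (\<lambda>c. - a c, \<lambda>c. - b c, \<lambda>c. - (Pum c * h_bu c))])"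

definition lower :: "decoding_order \<Rightarrow> halfplane list" where
  "lower ord = concat (map lower_of (margins ord))"

lemma decodable_margins:
  "decodable ord c x y u \<longleftrightarrow> (\<forall>(a, b) \<in> set (margins ord). u * h_bu c \<le> a c * x + b c * y)"
  by (cases ord) (auto simp: algebra_simps)

text \<open>\<open>Pu_min\<close> is a maximum, so a bound on \<open>Pu_min c x y * h_bu c\<close>
  splits into one bound per term; clearing the positive denominators turns each into a halfplane of
  \<open>lower_of\<close>.\<close>

lemma lower_margins:
  assumes "admissible c"
  shows "(\<forall>H\<in>set (lower ord). lhs H c (x, y) \<le> rhs H c) \<longleftrightarrow> decodable ord c x y (Pu_min c x y)"
proof -
  have pos: "h_d1u c > 0" "h_d2u c > 0" "h_bu c > 0"
    using assms by (auto simp: admissible_def)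
  have "Pu_min c x y * h_bu c \<le> z \<longleftrightarrow>
      (eta1 c * x + h_d c * y) * h_bu c \<le> h_d1u c * z \<and>
      (h_d c * x + eta2 c * y) * h_bu c \<le> h_d2u c * z \<and> Pum c * h_bu c \<le> z" for z
    using pos unfolding Pu_min_def
    by (simp add: pos_le_divide_eq[symmetric] pos_divide_le_eq) (auto simp: field_simps)
  then have "(\<forall>H\<in>set (lower_of m). lhs H c (x, y) \<le> rhs H c) \<longleftrightarrow>
      Pu_min c x y * h_bu c \<le> fst m c * x + snd m c * y" for m
    by (cases m) (auto simp: lower_of_def lhs_def rhs_def algebra_simps)
  then show ?thesis
    unfolding decodable_margins lower_def set_concat set_map by (simp add: split_beta)
qed

text \<open>In either order one decoding condition bounds one received power below by
  \<open>u * h_bu c > 0\<close>, and the other makes the second received power exceed the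
  first.\<close>

lemma projD_pos:
  assumes "admissible c" "(x, y) \<in> projD ord c"
  shows "0 < x" "0 < y"
proof -
  obtain u where u: "u \<ge> Pum c" "decodable ord c x y u"
    using assms(2) by (auto simp: projD_def feasible_def)
  have pos: "h_bu c > 0" "h_bd1 c > 0" "h_bd2 c > 0" "Pum c > 0"
    using assms(1) by (auto simp: admissible_def)
  then have "u * h_bu c > 0" using u by simp
  with u(2) have "h_bd1 c * x > 0 \<and> h_bd2 c * y > 0"
    by (cases ord) (auto simp: algebra_simps)
  with pos show "0 < x" "0 < y" by (simp_all add: zero_less_mult_iff)
qed

text \<open>The power of \<open>u\<close> is eliminated by taking its smallest admissible value: the
  two oblique halfplanes of \<open>upper\<close> say that this value is at most
  \<open>PuM c\<close>, and \<open>lower\<close> is decodability at it. Nonnegativity of the powers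
  follows from decodability, so no halfplane stands for it.\<close>

lemma projD_eq:
  assumes c: "admissible c"
  shows "projD ord c = {p. \<forall>H\<in>set (upper @ lower ord). lhs H c p \<le> rhs H c}"
proof (intro set_eqI iffI)
  have pos: "h_d1u c > 0" "h_d2u c > 0" "h_bu c > 0" "h_bd1 c > 0" "h_bd2 c > 0" "Pum c > 0" "Pum c < PuM c"
    using c by (auto simp: admissible_def)
  have upper: "(\<forall>H\<in>set upper. lhs H c (x, y) \<le> rhs H c) \<longleftrightarrow>
      x \<le> P1M c \<and> y \<le> P2M c \<and> Pu_min c x y \<le> PuM c" for x y
    using pos by (simp add: upper_def lhs_def rhs_def Pu_min_def pos_divide_le_eq)
      (auto simp: algebra_simps)
  {
    fix p assume p: "p \<in> projD ord c"
    obtain x y where xy: "p = (x, y)" by (cases p)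
    have "(x, y, Pu_min c x y) \<in> feasible ord c"
      using Pu_min_least(1)[OF c] p xy by blast
    then show "p \<in> {p. \<forall>H\<in>set (upper @ lower ord). lhs H c p \<le> rhs H c}"
      using lower_margins[OF c, of ord x y] upper[of x y] unfolding xy feasible_def by auto
  next
    fix p assume p: "p \<in> {p. \<forall>H\<in>set (upper @ lower ord). lhs H c p \<le> rhs H c}"
    obtain x y where xy: "p = (x, y)" by (cases p)
    let ?u = "Pu_min c x y"
    have u: "x \<le> P1M c" "y \<le> P2M c" "?u \<le> PuM c" "decodable ord c x y ?u"
      using p upper[of x y] lower_margins[OF c, of ord x y] by (auto simp: xy)
    have le: "Pum c \<le> ?u" "(y * h_d c + x * eta1 c) / h_d1u c \<le> ?u"
        "(x * h_d c + y * eta2 c) / h_d2u c \<le> ?u"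
      by (simp_all add: Pu_min_def)
    have "?u * h_bu c > 0" using le pos by simp
    with u(4) have "h_bd1 c * x > 0 \<and> h_bd2 c * y > 0"
      by (cases ord) (auto simp: algebra_simps)
    with pos have "0 < x" "0 < y" by (simp_all add: zero_less_mult_iff)
    with u le pos have "(x, y, ?u) \<in> feasible ord c"
      by (simp add: feasible_def pos_divide_le_eq)
    then show "p \<in> projD ord c" unfolding projD_def xy by force
  }
qed

text \<open>The last claim is the curvature condition of \<open>rate_quasiconvex\<close> for the
  direction \<open>(- b, a)\<close> of the bounding line. Its two factors have equal sign on the
  lines parallel to an axis, and one of them vanishes on each oblique line.\<close>

lemma upper_coeffs:
  assumes "admissible c" "H \<in> set upper"
  shows "rhs H c > 0" "fst H c \<ge> 0" "fst (snd H) c \<ge> 0" "(fst H c, fst (snd H) c) \<noteq> 0"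
    and "0 \<le> (eta2 c * fst H c - h_d c * fst (snd H) c) * (h_d c * fst H c - eta1 c * fst (snd H) c)"
  using assms by (auto simp: upper_def rhs_def admissible_def zero_prod_def)

lemma lower_rhs: "admissible c \<Longrightarrow> H \<in> set (lower ord) \<Longrightarrow> rhs H c \<le> 0"
  by (auto simp: lower_def lower_of_def rhs_def admissible_def split: prod.splits)

lemma lhs_add: "lhs H c (p + q) = lhs H c p + lhs H c q"
  and lhs_diff: "lhs H c (p - q) = lhs H c p - lhs H c q"
  and lhs_scale: "lhs H c (t *\<^sub>R p) = t * lhs H c p"
  by (simp_all add: lhs_def algebra_simps)

lemma continuous_on_lhs: "continuous_on A (lhs H c)"
  unfolding lhs_def by (intro continuous_intros)

lemma lhs_upper_pos:
  assumes "admissible c" "H \<in> set upper" "0 < fst p" "0 < snd p"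
  shows "0 < lhs H c p"
proof -
  have "fst H c \<ge> 0" "fst (snd H) c \<ge> 0" "fst H c > 0 \<or> fst (snd H) c > 0"
    using upper_coeffs[OF assms(1,2)] by (auto simp: zero_prod_def)
  then show ?thesis unfolding lhs_def using assms(3,4) by (auto intro: add_pos_nonneg add_nonneg_pos)
qed

section \<open>Faces of the polygon and their shape\<close>

definition face :: "decoding_order \<Rightarrow> d2d \<Rightarrow> halfplane \<Rightarrow> (real \<times> real) set" where
  "face ord c H = {p \<in> projD ord c. lhs H c p = rhs H c}"

lemma faces_eq:
  assumes "admissible c"
  shows "E1 ord c = face ord c (upper ! 0)" "E2 ord c = face ord c (upper ! 1)"
    "EU2 ord c = face ord c (upper ! 2)" "EU4 ord c = face ord c (upper ! 3)"
  using assms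
  by (auto simp: E1_def E2_def EU2_def EU4_def face_def upper_def lhs_def rhs_def admissible_def
      divide_eq_eq algebra_simps numeral_eq_Suc)

lemma compact_projD:
  assumes c: "admissible c"
  shows "compact (projD ord c)"
proof -
  have "projD ord c = (\<Inter>H\<in>set (upper @ lower ord). {p. lhs H c p \<le> rhs H c})"
    using projD_eq[OF c] by auto
  moreover have "closed {p. lhs H c p \<le> rhs H c}" for H
    by (rule closed_Collect_le) (auto intro: continuous_on_lhs)
  ultimately have "closed (projD ord c)" by auto
  moreover have "projD ord c \<subseteq> {0..P1M c} \<times> {0..P2M c}"
    by (auto simp: projD_def feasible_def)
  then have "bounded (projD ord c)"
    by (rule bounded_subset[OF bounded_Times[OF bounded_closed_interval bounded_closed_interval]])
  ultimately show ?thesis by (simp add: compact_eq_bounded_closed)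
qed

lemma convex_projD:
  assumes c: "admissible c"
  shows "convex (projD ord c)"
  unfolding projD_eq[OF c]
proof (rule convexI)
  fix p q :: "real \<times> real" and s t :: real
  assume pq: "p \<in> {p. \<forall>H\<in>set (upper @ lower ord). lhs H c p \<le> rhs H c}"
    "q \<in> {p. \<forall>H\<in>set (upper @ lower ord). lhs H c p \<le> rhs H c}"
    and st: "0 \<le> s" "0 \<le> t" "s + t = 1"
  have "lhs H c (s *\<^sub>R p + t *\<^sub>R q) \<le> rhs H c" if "H \<in> set (upper @ lower ord)" for H
    unfolding lhs_add lhs_scale
    by (rule convex_bound_le) (use pq st that in auto)
  then show "s *\<^sub>R p + t *\<^sub>R q \<in> {p. \<forall>H\<in>set (upper @ lower ord). lhs H c p \<le> rhs H c}" by simp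
qed

lemma compact_face:
  assumes "admissible c"
  shows "compact (face ord c H)"
proof -
  have "closed {p. lhs H c p = rhs H c}"
    by (rule closed_Collect_eq) (auto intro: continuous_on_lhs)
  moreover have "face ord c H = projD ord c \<inter> {p. lhs H c p = rhs H c}"
    by (auto simp: face_def)
  ultimately show ?thesis using compact_projD[OF assms] by (simp add: compact_Int_closed)
qed

lemma convex_face:
  assumes "admissible c"
  shows "convex (face ord c H)"
proof (rule convexI)
  fix p q :: "real \<times> real" and s t :: real
  assume pq: "p \<in> face ord c H" "q \<in> face ord c H" and st: "0 \<le> s" "0 \<le> t" "s + t = 1"
  have "s *\<^sub>R p + t *\<^sub>R q \<in> projD ord c"
    using convexD[OF convex_projD[OF assms], of p ord q s t] pq st by (simp add: face_def)
  moreover have "lhs H c (s *\<^sub>R p + t *\<^sub>R q) = rhs H c"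
    using pq st by (simp add: face_def lhs_add lhs_scale flip: distrib_right)
  ultimately show "s *\<^sub>R p + t *\<^sub>R q \<in> face ord c H" by (simp add: face_def)
qed

text \<open>\<open>cross p q > 0\<close> means that \<open>q\<close> lies on a steeper ray than \<open>p\<close>.\<close>

definition cross :: "real \<times> real \<Rightarrow> real \<times> real \<Rightarrow> real" where
  "cross p q = fst p * snd q - snd p * fst q"

text \<open>The kernel of a nonzero linear form on the plane is spanned by its normal turned by a
  right angle; \<open>?k\<close> is the coefficient of the orthogonal projection of \<open>d\<close>
  onto that vector.\<close>

lemma line_direction:
  assumes "(fst H c, fst (snd H) c) \<noteq> 0" "lhs H c d = 0"
  obtains k where "d = k *\<^sub>R (- fst (snd H) c, fst H c)"
proof -
  let ?a = "fst H c" and ?b = "fst (snd H) c"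
  have n: "?a\<^sup>2 + ?b\<^sup>2 \<noteq> 0" using assms(1) by (simp add: zero_prod_def sum_power2_eq_zero_iff)
  have e: "?a * fst d + ?b * snd d = 0" using assms(2) by (simp add: lhs_def)
  let ?k = "(?a * snd d - ?b * fst d) / (?a\<^sup>2 + ?b\<^sup>2)"
  have "fst d * (?a\<^sup>2 + ?b\<^sup>2) = - ?b * (?a * snd d - ?b * fst d) + ?a * (?a * fst d + ?b * snd d)"
    "snd d * (?a\<^sup>2 + ?b\<^sup>2) = ?a * (?a * snd d - ?b * fst d) + ?b * (?a * fst d + ?b * snd d)"
    by (simp_all add: algebra_simps power2_eq_square)
  then have "fst d = ?k * - ?b" "snd d = ?k * ?a"
    using n unfolding e by (simp_all add: field_simps)
  then show ?thesis using that[of ?k] by (metis prod.collapse scaleR_Pair real_scaleR_def)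
qed

lemma face_segment:
  assumes c: "admissible c" and H: "H \<in> set upper" and ne: "face ord c H \<noteq> {}"
  obtains a b where "face ord c H = closed_segment a b"
proof (rule compact_convex_collinear_segment[OF ne compact_face[OF c] convex_face[OF c]])
  show "collinear (face ord c H)"
    unfolding collinear_def
  proof (intro exI[of _ "(- fst (snd H) c, fst H c)"] ballI)
    fix p q assume "p \<in> face ord c H" "q \<in> face ord c H"
    then have "lhs H c (p - q) = 0" by (simp add: face_def lhs_diff)
    then show "\<exists>k. p - q = k *\<^sub>R (- fst (snd H) c, fst H c)"
      using line_direction upper_coeffs(4)[OF c H] by metis
  qed
qed

lemma endpoints_closed_segment: "endpoints (closed_segment a b) = {a, b}"
  for a b :: "'a::euclidean_space"
  unfolding endpoints_def by (auto simp: closed_segment_commute closed_segment_eq doubleton_eq_iff)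

lemma endpoint_extreme:
  fixes S :: "'a::euclidean_space set"
  shows "p \<in> endpoints S \<Longrightarrow> p extreme_point_of S"
  unfolding endpoints_def by (auto simp: extreme_point_of_segment)

section \<open>The rate along rays and faces\<close>

text \<open>The product of the two factors 1 + SINR over a common denominator. The rate is an
  increasing function of it, so rates can be compared through a rational function.\<close>

definition gain :: "d2d \<Rightarrow> real \<times> real \<Rightarrow> real" where
  "gain c = (\<lambda>(x, y). (x * h_d c + (y * eta2 c + sigma2 c)) * (y * h_d c + (x * eta1 c + sigma2 c)) /
     ((y * eta2 c + sigma2 c) * (x * eta1 c + sigma2 c)))"

lemma noise_pos:
  assumes "admissible c" "0 \<le> x" "0 \<le> y"
  shows "0 < y * eta2 c + sigma2 c" "0 < x * eta1 c + sigma2 c" "0 \<le> x * h_d c" "0 \<le> y * h_d c"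
  using assms by (auto simp: admissible_def intro: add_nonneg_pos)

lemma gain_pos: "admissible c \<Longrightarrow> 0 \<le> x \<Longrightarrow> 0 \<le> y \<Longrightarrow> 0 < gain c (x, y)"
  using noise_pos[of c x y] by (simp add: gain_def add_nonneg_pos)

lemma rate_gain:
  assumes "admissible c" "0 \<le> x" "0 \<le> y"
  shows "rate c (x, y) = B0 c * log 2 (gain c (x, y))"
proof -
  note pos = noise_pos[OF assms]
  have "gain c (x, y) = (1 + x * h_d c / (y * eta2 c + sigma2 c)) * (1 + y * h_d c / (x * eta1 c + sigma2 c))"
    using pos by (simp add: gain_def field_simps)
  moreover have "0 < 1 + x * h_d c / (y * eta2 c + sigma2 c)" "0 < 1 + y * h_d c / (x * eta1 c + sigma2 c)"
    using pos by (simp_all add: add_pos_nonneg)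
  ultimately have "log 2 (gain c (x, y)) =
      log 2 (1 + x * h_d c / (y * eta2 c + sigma2 c)) + log 2 (1 + y * h_d c / (x * eta1 c + sigma2 c))"
    by (simp only: log_mult_pos)
  then show ?thesis by (simp add: rate_def distrib_left)
qed

lemma rate_le_iff:
  assumes "admissible c" "0 \<le> fst p" "0 \<le> snd p" "0 \<le> fst q" "0 \<le> snd q"
  shows "rate c p \<le> rate c q \<longleftrightarrow> gain c p \<le> gain c q"
proof -
  have "B0 c > 0" using assms by (simp add: admissible_def)
  then show ?thesis
    using assms gain_pos[of c "fst p" "snd p"] gain_pos[of c "fst q" "snd q"]
      rate_gain[of c "fst p" "snd p"] rate_gain[of c "fst q" "snd q"]
    by simp
qed

text \<open>Scaling multiplies signal and interference by \<open>t\<close> but leaves the noise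
  \<open>s\<close> fixed; after clearing denominators only
  \<open>a * h * s \<le> t * (a * h * s)\<close> remains.\<close>

lemma sinr_scale_le:
  fixes a b h s t :: real
  assumes "0 \<le> a" "0 \<le> b" "0 < s" "0 \<le> h" "1 \<le> t"
  shows "1 + a * h / (b + s) \<le> 1 + t * a * h / (t * b + s)"
proof -
  have "0 < b + s" "0 < t * b + s" using assms by (simp_all add: add_nonneg_pos)
  moreover have "a * h * s \<le> t * (a * h * s)"
    using mult_right_mono[OF assms(5), of "a * h * s"] assms by simp
  ultimately show ?thesis by (simp add: field_simps)
qed

lemma rate_scale_le:
  assumes "admissible c" "0 \<le> x" "0 \<le> y" "1 \<le> t"
  shows "rate c (x, y) \<le> rate c (t *\<^sub>R (x, y))"
proof -
  have pos: "0 < eta1 c" "0 < eta2 c" "0 < sigma2 c" "0 < h_d c" "0 < B0 c"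
    using assms(1) by (auto simp: admissible_def)
  have log: "log 2 (1 + a * h_d c / (b + sigma2 c)) \<le> log 2 (1 + t * a * h_d c / (t * b + sigma2 c))"
    if "0 \<le> a" "0 \<le> b" for a b
  proof (rule log_mono)
    have "0 \<le> a * h_d c / (b + sigma2 c)" using that pos by (simp add: add_nonneg_pos)
    then show "0 < 1 + a * h_d c / (b + sigma2 c)" by linarith
    show "1 + a * h_d c / (b + sigma2 c) \<le> 1 + t * a * h_d c / (t * b + sigma2 c)"
      using sinr_scale_le[of a b "sigma2 c" "h_d c" t] that assms(4) pos by simp
  qed simp
  have "log 2 (1 + x * h_d c / (y * eta2 c + sigma2 c)) \<le> log 2 (1 + t * x * h_d c / (t * (y * eta2 c) + sigma2 c))"
    "log 2 (1 + y * h_d c / (x * eta1 c + sigma2 c)) \<le> log 2 (1 + t * y * h_d c / (t * (x * eta1 c) + sigma2 c))"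
    using log[of x "y * eta2 c"] log[of y "x * eta1 c"] assms pos by simp_all
  then show ?thesis
    using pos by (simp add: rate_def mult.assoc add_mono)
qed

text \<open>With \<open>M\<close> the gain at the intermediate point, numerator minus \<open>M\<close> times denominator is a
  quadratic polynomial along the segment whose leading coefficient is nonnegative by the two
  hypotheses on the direction; it vanishes at the intermediate point, so it cannot be negative
  at both ends.\<close>

lemma rate_quasiconvex:
  assumes c: "admissible c" and p: "0 \<le> x" "0 \<le> y" and q: "0 \<le> x'" "0 \<le> y'"
    and t: "0 \<le> t" "t \<le> 1"
    and dir: "(x' - x) * (y' - y) \<le> 0"
      "0 \<le> (h_d c * (x' - x) + eta2 c * (y' - y)) * (h_d c * (y' - y) + eta1 c * (x' - x))"
  shows "rate c ((1 - t) *\<^sub>R (x, y) + t *\<^sub>R (x', y')) \<le> max (rate c (x, y)) (rate c (x', y'))"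
proof -
  define N where "N u v = (u * h_d c + (v * eta2 c + sigma2 c)) * (v * h_d c + (u * eta1 c + sigma2 c))" for u v
  define D where "D u v = (v * eta2 c + sigma2 c) * (u * eta1 c + sigma2 c)" for u v
  have D: "0 < D u v" if "0 \<le> u" "0 \<le> v" for u v
    using noise_pos[OF c that] by (simp add: D_def)
  have gain: "gain c (u, v) = N u v / D u v" for u v by (simp add: gain_def N_def D_def)
  define z w where "z = (1 - t) * x + t * x'" and "w = (1 - t) * y + t * y'"
  have zw: "0 \<le> z" "0 \<le> w" using p q t by (simp_all add: z_def w_def)
  define M where "M = gain c (z, w)"
  have M: "0 < M" unfolding M_def by (rule gain_pos[OF c zw])
  define Q where "Q = (h_d c * (x' - x) + eta2 c * (y' - y)) * (h_d c * (y' - y) + eta1 c * (x' - x))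
      - M * (eta1 c * eta2 c * ((x' - x) * (y' - y)))"
  have e: "eta1 c * eta2 c > 0" using c by (simp add: admissible_def)
  have "M * (eta1 c * eta2 c * ((x' - x) * (y' - y))) \<le> 0"
    using M e dir(1) by (simp add: mult_le_0_iff)
  then have "0 \<le> Q" using dir(2) by (simp add: Q_def)
  have "N z w - M * D z w = 0" using D[OF zw] by (simp add: M_def gain)
  \<comment> \<open>A quadratic with leading coefficient \<open>Q\<close> along the segment differs
    at \<open>t\<close> from the linear interpolation of its end values by
    \<open>- t * (1 - t) * Q\<close>.\<close>
  moreover have "N z w - M * D z w =
      (1 - t) * (N x y - M * D x y) + t * (N x' y' - M * D x' y') - t * (1 - t) * Q"
    unfolding N_def D_def Q_def z_def w_def by (simp add: algebra_simps)
  moreover have "0 \<le> t * (1 - t) * Q" using t \<open>0 \<le> Q\<close> by simp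
  ultimately have "0 \<le> (1 - t) * (N x y - M * D x y) + t * (N x' y' - M * D x' y')" by linarith
  then have "0 \<le> N x y - M * D x y \<or> 0 \<le> N x' y' - M * D x' y'"
    using convex_bound_lt[of "N x y - M * D x y" 0 "N x' y' - M * D x' y'" "1 - t" t] t by fastforce
  then have "M \<le> gain c (x, y) \<or> M \<le> gain c (x', y')"
    using D p q by (auto simp: gain pos_le_divide_eq)
  then show ?thesis
    using rate_le_iff[OF c, of "(z, w)"] zw p q by (auto simp: M_def z_def w_def le_max_iff_disj)
qed

text \<open>A face has direction \<open>k\<close> times \<open>(- b, a)\<close> with
  \<open>a\<close> and \<open>b\<close> nonnegative, so the coordinates change in opposite senses,
  and the other condition of \<open>rate_quasiconvex\<close> is \<open>k\<^sup>2\<close> times the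
  product in \<open>upper_coeffs\<close>.\<close>

lemma face_rate_le_endpoints:
  assumes c: "admissible c" and H: "H \<in> set upper"
    and face: "face ord c H = closed_segment p q" and r: "r \<in> face ord c H"
  shows "rate c r \<le> max (rate c p) (rate c q)"
proof -
  let ?a = "fst H c" and ?b = "fst (snd H) c"
  have pq: "p \<in> face ord c H" "q \<in> face ord c H" by (simp_all add: face)
  then have "lhs H c (q - p) = 0" by (simp add: face_def lhs_diff)
  then obtain k where k: "q - p = k *\<^sub>R (- ?b, ?a)"
    using line_direction upper_coeffs(4)[OF c H] by metis
  obtain t where t: "0 \<le> t" "t \<le> 1" "r = (1 - t) *\<^sub>R p + t *\<^sub>R q"
    using r face by (auto simp: in_segment)
  obtain x y x' y' where xy: "p = (x, y)" "q = (x', y')" by (cases p, cases q)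
  have d: "x' - x = - (k * ?b)" "y' - y = k * ?a" using k by (simp_all add: xy)
  show ?thesis unfolding t(3) xy
  proof (rule rate_quasiconvex[OF c _ _ _ _ t(1,2)])
    show "0 \<le> x" "0 \<le> y" "0 \<le> x'" "0 \<le> y'"
      using pq projD_pos[OF c] unfolding face_def xy by (blast intro: less_imp_le)+
    have "(x' - x) * (y' - y) = - (k\<^sup>2 * (?a * ?b))"
      unfolding d by (simp add: power2_eq_square algebra_simps)
    then show "(x' - x) * (y' - y) \<le> 0" using upper_coeffs(2,3)[OF c H] by simp
    have "(h_d c * (x' - x) + eta2 c * (y' - y)) * (h_d c * (y' - y) + eta1 c * (x' - x)) =
        k\<^sup>2 * ((eta2 c * ?a - h_d c * ?b) * (h_d c * ?a - eta1 c * ?b))"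
      unfolding d by (simp add: power2_eq_square algebra_simps)
    then show "0 \<le> (h_d c * (x' - x) + eta2 c * (y' - y)) * (h_d c * (y' - y) + eta1 c * (x' - x))"
      using upper_coeffs(5)[OF c H] by simp
  qed
qed

lemma face_arg_max_endpoint:
  assumes c: "admissible c" and H: "H \<in> set upper" and ne: "face ord c H \<noteq> {}"
  shows "\<exists>p \<in> endpoints (face ord c H). is_arg_max (rate c) (\<lambda>q. q \<in> face ord c H) p"
proof -
  obtain p q where face: "face ord c H = closed_segment p q"
    using face_segment[OF c H ne] .
  have le: "rate c r \<le> max (rate c p) (rate c q)" if "r \<in> face ord c H" for r
    by (rule face_rate_le_endpoints[OF c H face that])
  have "is_arg_max (rate c) (\<lambda>r. r \<in> face ord c H) (if rate c p \<le> rate c q then q else p)"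
    unfolding is_arg_max_linorder using le by (auto simp: face)
  then show ?thesis by (auto simp: face endpoints_closed_segment split: if_splits)
qed

text \<open>The factor \<open>t\<close> is the reciprocal of the largest ratio of \<open>lhs\<close>
  to \<open>rhs\<close> over \<open>upper\<close>, so the halfplane attaining it becomes tight and
  no other one of \<open>upper\<close> is violated. The bounds in \<open>lower\<close> are
  nonpositive and survive scaling by \<open>t \<ge> 1\<close>. The maximality of the ratio is
  exported because it later identifies the face that is hit.\<close>

lemma projD_scale_to_face:
  assumes c: "admissible c" and r: "r \<in> projD ord c"
  obtains H t where "H \<in> set upper" "1 \<le> t" "t *\<^sub>R r \<in> face ord c H"
    "\<And>K. K \<in> set upper \<Longrightarrow> lhs K c r / rhs K c \<le> lhs H c r / rhs H c"
proof -
  let ?f = "\<lambda>K. lhs K c r / rhs K c"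
  have "Max (?f ` set upper) \<in> ?f ` set upper"
    by (rule Max_in) (simp_all add: upper_def)
  then obtain H where H: "H \<in> set upper" and Max: "Max (?f ` set upper) = ?f H" by blast
  have max: "?f K \<le> ?f H" if "K \<in> set upper" for K
    unfolding Max[symmetric] by (rule Max_ge) (use that in simp_all)
  have r': "0 < fst r" "0 < snd r" using projD_pos[OF c, of "fst r" "snd r"] r by auto
  have pos: "0 < lhs K c r" "0 < rhs K c" if "K \<in> set upper" for K
    using lhs_upper_pos[OF c that r'] upper_coeffs(1)[OF c that] .
  have le: "lhs K c r \<le> rhs K c" if "K \<in> set (upper @ lower ord)" for K
    using r that unfolding projD_eq[OF c] by blast
  define t where "t = rhs H c / lhs H c r"
  have t: "1 \<le> t" using le[of H] pos[OF H] H by (simp add: t_def)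
  have "t *\<^sub>R r \<in> projD ord c"
    unfolding projD_eq[OF c]
  proof (intro CollectI ballI)
    fix K assume "K \<in> set (upper @ lower ord)"
    then consider "K \<in> set upper" | "K \<in> set (lower ord)" by auto
    then show "lhs K c (t *\<^sub>R r) \<le> rhs K c"
    proof cases
      case 1
      then show ?thesis
        using max[OF 1] pos[OF 1] pos[OF H] by (simp add: lhs_scale t_def field_simps)
    next
      case 2
      then have "lhs K c r \<le> rhs K c" "rhs K c \<le> 0" using le lower_rhs[OF c 2] by auto
      then have "t * lhs K c r \<le> t * rhs K c" "t * rhs K c \<le> 1 * rhs K c"
        using t mult_right_mono_neg[of 1 t "rhs K c"] by (simp_all add: mult_left_mono)
      then show ?thesis by (simp add: lhs_scale)
    qed
  qed
  moreover have "lhs H c (t *\<^sub>R r) = rhs H c"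
    using pos[OF H] by (simp add: lhs_scale t_def)
  ultimately have "t *\<^sub>R r \<in> face ord c H" by (simp add: face_def)
  with H t max show ?thesis using that by blast
qed

definition face_endpoints :: "decoding_order \<Rightarrow> d2d \<Rightarrow> (real \<times> real) set" where
  "face_endpoints ord c = (\<Union>H\<in>set upper. endpoints (face ord c H))"

lemma endpoints_subset: "endpoints S \<subseteq> S" for S :: "'a::euclidean_space set"
  unfolding endpoints_def by auto

text \<open>Scaling moves the point onto a face without loss of rate, and quasiconvexity then moves
  it to an endpoint of that face.\<close>

lemma endpoint_above:
  assumes c: "admissible c" and r: "r \<in> projD ord c"
  shows "\<exists>p \<in> face_endpoints ord c. rate c r \<le> rate c p"
proof -
  obtain H t where H: "H \<in> set upper" "1 \<le> t" "t *\<^sub>R r \<in> face ord c H"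
    using projD_scale_to_face[OF c r] by metis
  then obtain p where p: "p \<in> endpoints (face ord c H)"
      "is_arg_max (rate c) (\<lambda>q. q \<in> face ord c H) p"
    using face_arg_max_endpoint[OF c H(1)] by blast
  have "rate c r \<le> rate c (t *\<^sub>R r)"
    using rate_scale_le[OF c _ _ H(2), of "fst r" "snd r"] projD_pos[OF c, of "fst r" "snd r" ord] r by simp
  also have "\<dots> \<le> rate c p" using p(2) H(3) unfolding is_arg_max_linorder by blast
  finally show ?thesis using p(1) H(1) by (auto simp: face_endpoints_def)
qed

section \<open>Counting endpoints\<close>

text \<open>The steepest points of a face, and below the flattest points of the whole chain. Both
  are sets rather than chosen points, so that empty faces need no separate treatment in the
  count.\<close>

definition tops :: "decoding_order \<Rightarrow> d2d \<Rightarrow> halfplane \<Rightarrow> (real \<times> real) set" where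
  "tops ord c H = {p \<in> face ord c H. \<forall>q \<in> face ord c H. 0 \<le> cross q p}"

definition bottoms :: "decoding_order \<Rightarrow> d2d \<Rightarrow> (real \<times> real) set" where
  "bottoms ord c = {p \<in> \<Union>(face ord c ` set upper). \<forall>q \<in> \<Union>(face ord c ` set upper). 0 \<le> cross p q}"

lemma cross_commute: "cross q p = - cross p q"
  by (simp add: cross_def)

text \<open>Write \<open>p\<close> as \<open>k\<close> times \<open>q\<close>. Since
  \<open>q\<close> obeys the bound that is tight at \<open>p\<close>, \<open>k \<ge> 1\<close>;
  since \<open>p\<close> obeys the bound that is tight at \<open>q\<close>,
  \<open>k \<le> 1\<close>.\<close>

lemma same_ray_face_eq:
  assumes c: "admissible c" and H: "H \<in> set upper" "p \<in> face ord c H"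
    and K: "K \<in> set upper" "q \<in> face ord c K" and ray: "cross p q = 0"
  shows "p = q"
proof -
  have D: "p \<in> projD ord c" "q \<in> projD ord c" using H(2) K(2) by (simp_all add: face_def)
  then have pos: "0 < fst p" "0 < snd p" "0 < fst q" "0 < snd q"
    using projD_pos[OF c, of "fst p" "snd p" ord] projD_pos[OF c, of "fst q" "snd q" ord] by simp_all
  define k where "k = fst p / fst q"
  have p: "p = k *\<^sub>R q"
    using pos ray by (intro prod_eqI) (simp_all add: k_def cross_def field_simps)
  have le: "lhs L c r \<le> rhs L c" if "L \<in> set upper" "r \<in> projD ord c" for L r
    using that unfolding projD_eq[OF c] by simp
  have "rhs H c = k * lhs H c q" using H(2) by (simp add: face_def p lhs_scale)
  moreover have "lhs H c q \<le> rhs H c" "0 < lhs H c q"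
    using le[OF H(1) D(2)] lhs_upper_pos[OF c H(1) pos(3,4)] .
  ultimately have "1 \<le> k" by (metis mult_le_cancel_right1 not_less)
  have "k * rhs K c \<le> rhs K c" "0 < rhs K c"
    using K(2) le[OF K(1) D(1)] upper_coeffs(1)[OF c K(1)] by (simp_all add: face_def p lhs_scale)
  then have "k \<le> 1" by simp
  with \<open>1 \<le> k\<close> show ?thesis using p by simp
qed

lemma card_le_1_if_unique:
  assumes "\<And>p q. p \<in> A \<Longrightarrow> q \<in> A \<Longrightarrow> p = q"
  shows "finite A \<and> card A \<le> 1"
proof (cases "A = {}")
  case False
  then obtain a where "A = {a}" using assms by blast
  then show ?thesis by simp
qed simp

lemma card_tops:
  assumes c: "admissible c" and H: "H \<in> set upper"
  shows "finite (tops ord c H) \<and> card (tops ord c H) \<le> 1"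
proof (rule card_le_1_if_unique)
  fix p q assume "p \<in> tops ord c H" "q \<in> tops ord c H"
  then have pq: "p \<in> face ord c H" "q \<in> face ord c H" "0 \<le> cross p q" "0 \<le> cross q p"
    by (auto simp: tops_def)
  then have "cross p q = 0" using cross_commute[of p q] by simp
  with pq show "p = q" using same_ray_face_eq[OF c H _ H] by blast
qed

lemma card_bottoms:
  assumes c: "admissible c"
  shows "finite (bottoms ord c) \<and> card (bottoms ord c) \<le> 1"
proof (rule card_le_1_if_unique)
  fix p q assume "p \<in> bottoms ord c" "q \<in> bottoms ord c"
  then obtain H K where pq: "H \<in> set upper" "p \<in> face ord c H" "K \<in> set upper" "q \<in> face ord c K"
    "0 \<le> cross p q" "0 \<le> cross q p" unfolding bottoms_def by blast
  then have "cross p q = 0" using cross_commute[of p q] by simp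
  with pq show "p = q" using same_ray_face_eq[OF c] by blast
qed

text \<open>The faces form a chain that meets every ray at most once, so each endpoint \<open>p\<close> other than the
  first one is the last point of some face: near \<open>p\<close> on its flatter side the chain belongs to a face
  \<open>J\<close> through \<open>p\<close>, and \<open>J\<close> cannot continue beyond \<open>p\<close> without lying in the face of which \<open>p\<close> is
  an endpoint.\<close>

lemma endpoint_bottom_or_top:
  assumes c: "admissible c" and H: "H \<in> set upper" and p: "p \<in> endpoints (face ord c H)"
    and nb: "p \<notin> bottoms ord c"
  shows "\<exists>J \<in> set upper. p \<in> tops ord c J"
proof -
  have pH: "p \<in> face ord c H" using p endpoints_subset by blast
  then have pD: "p \<in> projD ord c" by (simp add: face_def)
  have "p \<in> \<Union>(face ord c ` set upper)" using H pH by blast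
  then obtain M m where M: "M \<in> set upper" "m \<in> face ord c M" "\<not> 0 \<le> cross p m"
    using nb unfolding bottoms_def by blast
  then have mD: "m \<in> projD ord c" by (simp add: face_def)
  have le: "lhs L c r \<le> rhs L c" if "L \<in> set upper" "r \<in> projD ord c" for L r
    using that unfolding projD_eq[OF c] by simp
  have pos: "0 < rhs L c" if "L \<in> set upper" for L using upper_coeffs(1)[OF c that] .
  \<comment> \<open>\<open>R\<close> moves from \<open>p\<close> toward the strictly flatter point
    \<open>m\<close>; \<open>\<rho>\<close> is the ratio by which \<open>projD_scale_to_face\<close>
    selects a face.\<close>
  define R where "R e = p + e *\<^sub>R (m - p)" for e :: real
  define \<rho> where "\<rho> L e = lhs L c (R e) / rhs L c" for L e
  have lim: "((\<lambda>e. \<rho> L e) \<longlongrightarrow> lhs L c p / rhs L c) (at_right 0)" for L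
  proof -
    have "((\<lambda>e. (lhs L c p + e * lhs L c (m - p)) / rhs L c) \<longlongrightarrow>
        (lhs L c p + 0 * lhs L c (m - p)) / rhs L c) (at_right 0)"
      unfolding divide_inverse by (intro tendsto_intros)
    then show ?thesis by (simp add: \<rho>_def R_def lhs_add lhs_scale)
  qed
  \<comment> \<open>At \<open>p\<close> the ratio of \<open>H\<close> is 1 and that of a slack
    halfplane is smaller. By continuity the strict order persists nearby, and finitely many
    halfplanes share one \<open>e\<close>.\<close>
  have "\<forall>\<^sub>F e in at_right 0. \<forall>L\<in>set upper. lhs L c p < rhs L c \<longrightarrow> \<rho> L e < \<rho> H e"
  proof (intro eventually_ball_finite ballI)
    fix L assume L: "L \<in> set upper"
    show "\<forall>\<^sub>F e in at_right 0. lhs L c p < rhs L c \<longrightarrow> \<rho> L e < \<rho> H e"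
    proof (cases "lhs L c p < rhs L c")
      case True
      have "lhs L c p / rhs L c < lhs H c p / rhs H c"
        using True pos[OF L] pos[OF H] pH by (simp add: face_def)
      then obtain z where "lhs L c p / rhs L c < z" "z < lhs H c p / rhs H c"
        using dense by blast
      then have "\<forall>\<^sub>F e in at_right 0. \<rho> L e < z" "\<forall>\<^sub>F e in at_right 0. z < \<rho> H e"
        using order_tendstoD[OF lim] by blast+
      then show ?thesis by eventually_elim simp
    qed simp
  qed simp
  moreover have "\<forall>\<^sub>F e in at_right 0. 0 < e \<and> e < (1::real)"
    by (intro eventually_conj eventually_at_right_less eventually_at_right_real[THEN eventually_mono, of 0 1]) auto
  ultimately have "\<forall>\<^sub>F e in at_right 0. (\<forall>L\<in>set upper. lhs L c p < rhs L c \<longrightarrow> \<rho> L e < \<rho> H e) \<and> 0 < e \<and> e < 1"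
    by (rule eventually_conj)
  then obtain e where e: "0 < e" "e < 1"
    and small: "\<And>L. L \<in> set upper \<Longrightarrow> lhs L c p < rhs L c \<Longrightarrow> \<rho> L e < \<rho> H e"
    using eventually_happens'[OF trivial_limit_at_right_real] by blast
  define r where "r = R e"
  have r: "r = (1 - e) *\<^sub>R p + e *\<^sub>R m" by (simp add: r_def R_def algebra_simps)
  have "r \<in> projD ord c"
    unfolding r using convexD[OF convex_projD[OF c] pD mD, of "1 - e" e] e by simp
  then obtain J t where J: "J \<in> set upper" "1 \<le> t" "t *\<^sub>R r \<in> face ord c J"
    and max: "\<And>K. K \<in> set upper \<Longrightarrow> lhs K c r / rhs K c \<le> lhs J c r / rhs J c"
    using projD_scale_to_face[OF c] by metis
  \<comment> \<open>\<open>J\<close> has the largest ratio at \<open>r\<close>, where every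
    halfplane slack at \<open>p\<close> falls below \<open>H\<close>; hence \<open>J\<close> is
    tight at \<open>p\<close>.\<close>
  have "\<not> lhs J c p < rhs J c"
    using small[OF J(1)] max[OF H] by (auto simp: \<rho>_def r_def)
  then have pJ: "p \<in> face ord c J" using le[OF J(1) pD] pD by (simp add: face_def)
  define r' where "r' = t *\<^sub>R r"
  have r'J: "r' \<in> face ord c J" using J(3) by (simp add: r'_def)
  have "cross r' p = t * e * - cross p m"
    by (simp add: r'_def r cross_def algebra_simps)
  moreover have "0 < t * e * - cross p m" using J(2) e M(3) by (intro mult_pos_pos) auto
  ultimately have \<beta>: "0 < cross r' p" by simp
  have "p \<in> tops ord c J"
  proof (rule ccontr)
    assume "p \<notin> tops ord c J"
    then obtain q where q: "q \<in> face ord c J" "cross q p < 0"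
      using pJ by (auto simp: tops_def not_le)
    define \<alpha> \<beta> where "\<alpha> = cross p q" and "\<beta> = cross r' p"
    have \<alpha>\<beta>: "0 < \<alpha>" "0 < \<beta>" using \<beta> q(2) cross_commute[of p q] by (simp_all add: \<alpha>_def \<beta>_def)
    \<comment> \<open>The linear dependence of three plane vectors, with cross products as
      coefficients. Applying the form of \<open>J\<close>, tight at all three, gives the coefficient
      sum. Applying that of \<open>H\<close> shows a weighted mean of two values at most
      \<open>rhs H c\<close> to equal \<open>rhs H c\<close>, so both points lie on the face of
      \<open>H\<close>.\<close>
    have id: "\<alpha> *\<^sub>R r' + \<beta> *\<^sub>R q = cross r' q *\<^sub>R p"
      by (intro prod_eqI) (simp_all add: \<alpha>_def \<beta>_def cross_def algebra_simps)
    have "\<alpha> * lhs J c r' + \<beta> * lhs J c q = cross r' q * lhs J c p"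
      using arg_cong[OF id, of "lhs J c"] by (simp add: lhs_add lhs_scale)
    then have "(\<alpha> + \<beta>) * rhs J c = cross r' q * rhs J c"
      using r'J q(1) pJ by (simp add: face_def distrib_right)
    then have sum: "cross r' q = \<alpha> + \<beta>" using pos[OF J(1)] by simp
    have "\<alpha> * lhs H c r' + \<beta> * lhs H c q = (\<alpha> + \<beta>) * rhs H c"
      using arg_cong[OF id, of "lhs H c"] pH by (simp add: lhs_add lhs_scale sum face_def)
    moreover have rq: "r' \<in> projD ord c" "q \<in> projD ord c" using r'J q(1) by (simp_all add: face_def)
    then have "\<alpha> * lhs H c r' \<le> \<alpha> * rhs H c" "\<beta> * lhs H c q \<le> \<beta> * rhs H c"
      using le[OF H] \<alpha>\<beta> by simp_all
    ultimately have "\<alpha> * lhs H c r' = \<alpha> * rhs H c" "\<beta> * lhs H c q = \<beta> * rhs H c"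
      unfolding distrib_right by linarith+
    then have rqH: "r' \<in> face ord c H" "q \<in> face ord c H" using rq \<alpha>\<beta> by (simp_all add: face_def)
    \<comment> \<open>Now \<open>p\<close> lies strictly between two points of the face of
      \<open>H\<close>, against its being an extreme point there.\<close>
    have "p = (1 / (\<alpha> + \<beta>)) *\<^sub>R ((\<alpha> + \<beta>) *\<^sub>R p)" using \<alpha>\<beta> by simp
    also have "\<dots> = (\<alpha> / (\<alpha> + \<beta>)) *\<^sub>R r' + (\<beta> / (\<alpha> + \<beta>)) *\<^sub>R q"
      unfolding sum[symmetric] id[symmetric] by (simp add: scaleR_add_right)
    also have "\<alpha> / (\<alpha> + \<beta>) = 1 - \<beta> / (\<alpha> + \<beta>)" using \<alpha>\<beta> by (simp add: field_simps)
    finally have "p = (1 - \<beta> / (\<alpha> + \<beta>)) *\<^sub>R r' + (\<beta> / (\<alpha> + \<beta>)) *\<^sub>R q" .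
    moreover have "r' \<noteq> q" using sum \<alpha>\<beta> by (auto simp: cross_def)
    moreover have "0 < \<beta> / (\<alpha> + \<beta>)" "\<beta> / (\<alpha> + \<beta>) < 1" using \<alpha>\<beta> by simp_all
    ultimately have "p \<in> open_segment r' q" unfolding in_segment by blast
    then show False
      using endpoint_extreme[OF p] rqH unfolding extreme_point_of_def by blast
  qed
  with J(1) show ?thesis by blast
qed

text \<open>One flattest point of the chain plus one steepest point for each of the four
  faces.\<close>

lemma card_face_endpoints:
  assumes c: "admissible c"
  shows "finite (face_endpoints ord c)" "card (face_endpoints ord c) \<le> 5"
proof -
  let ?T = "\<Union>H\<in>set upper. tops ord c H"
  have sub: "face_endpoints ord c \<subseteq> bottoms ord c \<union> ?T"
    using endpoint_bottom_or_top[OF c] unfolding face_endpoints_def by blast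
  have "card ?T \<le> (\<Sum>H\<in>set upper. card (tops ord c H))"
    by (rule card_UN_le) simp
  also have "\<dots> \<le> (\<Sum>H\<in>set upper. 1)"
    by (rule sum_mono) (use card_tops[OF c] in blast)
  also have "\<dots> \<le> length upper" by (simp add: card_length)
  finally have "card ?T \<le> 4" by (simp add: upper_def)
  moreover have fin: "finite (bottoms ord c \<union> ?T)"
    using card_tops[OF c] card_bottoms[OF c] by blast
  moreover have "card (bottoms ord c \<union> ?T) \<le> card (bottoms ord c) + card ?T" by (rule card_Un_le)
  ultimately show "card (face_endpoints ord c) \<le> 5"
    using card_mono[OF fin sub] card_bottoms[OF c, of ord] by linarith
  show "finite (face_endpoints ord c)" using fin sub by (rule rev_finite_subset)
qed

section \<open>Endpoints as crossings of bounding lines\<close>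

definition cross_coeffs :: "d2d \<Rightarrow> halfplane \<Rightarrow> halfplane \<Rightarrow> real" where
  "cross_coeffs c H K = fst H c * fst (snd K) c - fst K c * fst (snd H) c"

text \<open>\<open>cross_coeffs\<close> is the determinant of the two normals. If every line through
  \<open>p\<close> were parallel to that of \<open>H\<close>, small moves along it in both senses
  would stay in the face and \<open>p\<close> would be a midpoint, not an extreme point.\<close>

lemma endpoint_on_crossing_line:
  assumes c: "admissible c" and H: "H \<in> set upper" and p: "p \<in> endpoints (face ord c H)"
  shows "\<exists>K \<in> set (upper @ lower ord). cross_coeffs c H K \<noteq> 0 \<and> lhs K c p = rhs K c"
proof (rule ccontr)
  assume "\<not> ?thesis"
  then have par: "cross_coeffs c H K = 0" if "K \<in> set (upper @ lower ord)" "lhs K c p = rhs K c" for K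
    using that by blast
  have pH: "p \<in> face ord c H" using p endpoints_subset by blast
  define d where "d = (- fst (snd H) c, fst H c)"
  have d: "lhs K c d = cross_coeffs c H K" for K by (simp add: d_def lhs_def cross_coeffs_def)
  have "d \<noteq> 0" using upper_coeffs(4)[OF c H] by (auto simp: d_def zero_prod_def)
  \<comment> \<open>Tight constraints are constant along \<open>d\<close>, slack ones persist by
    continuity.\<close>
  have "\<forall>\<^sub>F e in at_right 0. \<forall>K\<in>set (upper @ lower ord).
      lhs K c (p + e *\<^sub>R d) \<le> rhs K c \<and> lhs K c (p - e *\<^sub>R d) \<le> rhs K c"
  proof (intro eventually_ball_finite ballI finite_set)
    fix K assume K: "K \<in> set (upper @ lower ord)"
    have le: "lhs K c p \<le> rhs K c"
      using pH K unfolding face_def projD_eq[OF c] by blast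
    show "\<forall>\<^sub>F e in at_right 0. lhs K c (p + e *\<^sub>R d) \<le> rhs K c \<and> lhs K c (p - e *\<^sub>R d) \<le> rhs K c"
    proof (cases "lhs K c p = rhs K c")
      case True
      then show ?thesis using par[OF K] by (simp add: lhs_add lhs_diff lhs_scale d)
    next
      case False
      have "((\<lambda>e. lhs K c p + e * lhs K c d) \<longlongrightarrow> lhs K c p + 0 * lhs K c d) (at_right 0)"
        "((\<lambda>e. lhs K c p - e * lhs K c d) \<longlongrightarrow> lhs K c p - 0 * lhs K c d) (at_right 0)"
        by (intro tendsto_intros)+
      then have "\<forall>\<^sub>F e in at_right 0. lhs K c p + e * lhs K c d < rhs K c"
        "\<forall>\<^sub>F e in at_right 0. lhs K c p - e * lhs K c d < rhs K c"
        using le False by (auto intro: order_tendstoD)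
      then show ?thesis
        by eventually_elim (simp add: lhs_add lhs_diff lhs_scale)
    qed
  qed
  then have "\<forall>\<^sub>F e in at_right 0. (\<forall>K\<in>set (upper @ lower ord).
      lhs K c (p + e *\<^sub>R d) \<le> rhs K c \<and> lhs K c (p - e *\<^sub>R d) \<le> rhs K c) \<and> 0 < e"
    by (intro eventually_conj eventually_at_right_less)
  then obtain e where "0 < e"
    and le: "\<forall>K\<in>set (upper @ lower ord). lhs K c (p + e *\<^sub>R d) \<le> rhs K c \<and> lhs K c (p - e *\<^sub>R d) \<le> rhs K c"
    using eventually_happens'[OF trivial_limit_at_right_real] by blast
  have "lhs H c d = 0" unfolding d by (simp add: cross_coeffs_def)
  then have "p + e *\<^sub>R d \<in> face ord c H" "p - e *\<^sub>R d \<in> face ord c H"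
    using le pH unfolding face_def projD_eq[OF c] by (simp_all add: lhs_add lhs_diff lhs_scale)
  moreover have neq: "p - e *\<^sub>R d \<noteq> p + e *\<^sub>R d"
  proof
    assume "p - e *\<^sub>R d = p + e *\<^sub>R d"
    then have "2 *\<^sub>R (e *\<^sub>R d) = 0" unfolding scaleR_2 by (simp add: algebra_simps)
    with \<open>0 < e\<close> \<open>d \<noteq> 0\<close> show False by simp
  qed
  moreover have "midpoint (p - e *\<^sub>R d) (p + e *\<^sub>R d) = p"
    by (simp add: midpoint_def flip: scaleR_2)
  then have "p \<in> open_segment (p - e *\<^sub>R d) (p + e *\<^sub>R d)"
    using midpoint_in_open_segment[of "p - e *\<^sub>R d" "p + e *\<^sub>R d"] neq by simp
  ultimately show False
    using endpoint_extreme[OF p] unfolding extreme_point_of_def by blast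
qed

section \<open>Computability by algebraic computation trees\<close>

fun depth :: "ctree \<Rightarrow> nat" where
  "depth (Output i j k) = 0"
| "depth (Do s t) = Suc (depth t)"
| "depth (IfLe i j t t') = Suc (max (depth t) (depth t'))"

text \<open>A run follows a single branch. The bound depends on the tree only, which is where the
  absolute constant comes from.\<close>

lemma exec_cost_le_depth: "exec r t xs = Some (P, n) \<Longrightarrow> n \<le> depth t"
proof (induction t arbitrary: xs n)
  case (Do s t)
  then show ?case by (fastforce split: if_splits)
next
  case (IfLe i j t t')
  then show ?case by (fastforce split: if_splits simp: le_max_iff_disj)
qed (auto split: if_splits)

text \<open>A list of functions of the problem data stands for the memory of all runs that have taken the
  same branches: it holds \<open>map (\<lambda>f. f c) fs\<close> on input \<open>c\<close>.\<close>

definition stored :: "d2d set \<Rightarrow> (d2d \<Rightarrow> real) list \<Rightarrow> (d2d \<Rightarrow> real) \<Rightarrow> bool" where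
  "stored S fs f \<longleftrightarrow> (\<exists>i<length fs. \<forall>c\<in>S. (fs ! i) c = f c)"

text \<open>The tree is chosen before the input, so one program has to serve all of
  \<open>S\<close>.\<close>

definition solvable ::
  "d2d set \<Rightarrow> (d2d \<Rightarrow> real) list \<Rightarrow> (d2d \<Rightarrow> real \<times> real \<times> real \<Rightarrow> bool) \<Rightarrow> bool" where
  "solvable S fs G \<longleftrightarrow>
     (\<exists>t. \<forall>c\<in>S. \<exists>P n. exec (rate c) t (map (\<lambda>f. f c) fs) = Some (P, n) \<and> G c P)"

definition input_fields :: "(d2d \<Rightarrow> real) list" where
  "input_fields = [h_d, h_bu, h_bd1, h_bd2, h_d1u, h_d2u, eta1, eta2, sigma2, B0, P1M, P2M, Pum, PuM]"

text \<open>Continuation-passing form: a task that can be solved from every memory that also holds \<open>f\<close> can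
  be solved without it.  The continuation ranges over subsets of \<open>T\<close> because the computation of \<open>f\<close>
  may branch.\<close>

definition computable :: "d2d set \<Rightarrow> (d2d \<Rightarrow> real) \<Rightarrow> bool" where
  "computable S f \<longleftrightarrow> (\<forall>T fs G. T \<subseteq> S \<longrightarrow> set input_fields \<subseteq> set fs \<longrightarrow>
     (\<forall>U gs. U \<subseteq> T \<longrightarrow> set fs \<subseteq> set gs \<longrightarrow> stored U gs f \<longrightarrow> solvable U gs G) \<longrightarrow>
     solvable T fs G)"

text \<open>Memories are compared as sets: addresses may shift, since \<open>stored\<close> asks
  only for some address.\<close>

lemma stored_mono: "stored S fs f \<Longrightarrow> T \<subseteq> S \<Longrightarrow> set fs \<subseteq> set gs \<Longrightarrow> stored T gs f"
  unfolding stored_def by (metis in_set_conv_nth subsetD)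

lemma stored_memI: "f \<in> set fs \<Longrightarrow> stored S fs f"
  unfolding stored_def by (metis in_set_conv_nth)

lemma computable_subset: "computable S f \<Longrightarrow> T \<subseteq> S \<Longrightarrow> computable T f"
  unfolding computable_def by (meson order_trans)

lemma stored_cong: "(\<And>c. c \<in> S \<Longrightarrow> f c = g c) \<Longrightarrow> stored S fs f = stored S fs g"
  unfolding stored_def by simp

lemma computable_cong:
  assumes f: "computable S f" and eq: "\<And>c. c \<in> S \<Longrightarrow> f c = g c"
  shows "computable S g"
proof -
  have "stored U fs g = stored U fs f" if "U \<subseteq> T" "T \<subseteq> S" for U T fs
    by (rule stored_cong) (use that eq in auto)
  with f show ?thesis
    unfolding computable_def by (smt (verit, ccfv_threshold))
qed

lemma computableD:
  assumes "computable S f" "T \<subseteq> S" "set input_fields \<subseteq> set fs"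
    and "\<And>U gs. U \<subseteq> T \<Longrightarrow> set fs \<subseteq> set gs \<Longrightarrow> stored U gs f \<Longrightarrow> solvable U gs G"
  shows "solvable T fs G"
  using assms unfolding computable_def by blast

text \<open>Two continuations nested; the first value is still in memory after the second is
  computed.\<close>

lemma computableD2:
  assumes f: "computable S f" and g: "computable S g" and T: "T \<subseteq> S"
    and fs: "set input_fields \<subseteq> set fs"
    and k: "\<And>U gs. U \<subseteq> T \<Longrightarrow> set fs \<subseteq> set gs \<Longrightarrow> stored U gs f \<Longrightarrow> stored U gs g \<Longrightarrow> solvable U gs G"
  shows "solvable T fs G"
proof (rule computableD[OF f T fs])
  fix U gs assume U: "U \<subseteq> T" and gs: "set fs \<subseteq> set gs" and f': "stored U gs f"
  show "solvable U gs G"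
  proof (rule computableD[OF g])
    show "U \<subseteq> S" using U T by simp
    show "set input_fields \<subseteq> set gs" using fs gs by simp
    fix V hs assume V: "V \<subseteq> U" and hs: "set gs \<subseteq> set hs" and g': "stored V hs g"
    show "solvable V hs G"
      by (rule k) (use V U gs hs g' stored_mono[OF f' V hs] in auto)
  qed
qed

lemma computable_input: "f \<in> set input_fields \<Longrightarrow> computable S f"
  unfolding computable_def by (meson order_refl stored_memI subsetD)

lemma computable_fields:
  "computable S h_d" "computable S h_bu" "computable S h_bd1" "computable S h_bd2"
  "computable S h_d1u" "computable S h_d2u" "computable S eta1" "computable S eta2"
  "computable S P1M" "computable S P2M" "computable S Pum" "computable S PuM"
  by (rule computable_input; simp add: input_fields_def)+

text \<open>The common template for single instructions: the tree for the memory extended by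
  \<open>h\<close> is prefixed with the instruction that produces \<open>h\<close>.\<close>

lemma computable_instr:
  assumes f: "computable S f" and g: "computable S g"
    and step: "\<And>c xs i j. c \<in> S \<Longrightarrow> i < length xs \<Longrightarrow> j < length xs \<Longrightarrow> xs ! i = f c \<Longrightarrow> xs ! j = g c \<Longrightarrow>
       legal xs (ins i j) \<and> result (rate c) xs (ins i j) = h c"
  shows "computable S h"
  unfolding computable_def
proof (intro allI impI)
  fix T fs G
  assume T: "T \<subseteq> S" and fs: "set input_fields \<subseteq> set fs"
    and k: "\<forall>U gs. U \<subseteq> T \<longrightarrow> set fs \<subseteq> set gs \<longrightarrow> stored U gs h \<longrightarrow> solvable U gs G"
  show "solvable T fs G"
  proof (rule computableD2[OF f g T fs])
    fix U gs
    assume U: "U \<subseteq> T" and gs: "set fs \<subseteq> set gs" and "stored U gs f" "stored U gs g"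
    then obtain i j where ij: "i < length gs" "j < length gs"
      "\<And>c. c \<in> U \<Longrightarrow> (gs ! i) c = f c \<and> (gs ! j) c = g c"
      unfolding stored_def by metis
    have s: "legal (map (\<lambda>f. f c) gs) (ins i j)" "result (rate c) (map (\<lambda>f. f c) gs) (ins i j) = h c"
      if "c \<in> U" for c
      using step[of c i "map (\<lambda>f. f c) gs" j] ij U T that by auto
    have "solvable U (gs @ [h]) G"
      using k U gs by (simp add: le_supI1 stored_memI subset_insertI2)
    then obtain t where "\<forall>c\<in>U. \<exists>P n.
        exec (rate c) t (map (\<lambda>f. f c) (gs @ [h])) = Some (P, n) \<and> G c P"
      unfolding solvable_def by blast
    then show "solvable U gs G"
      unfolding solvable_def by (intro exI[of _ "Do (ins i j) t"] ballI) (fastforce simp: s)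
  qed
qed

text \<open>The continuation is solved separately on each side of the comparison, and the two
  resulting trees become the branches of one \<open>IfLe\<close> node.\<close>

lemma computable_branch:
  assumes f: "computable S f" and g: "computable S g"
    and h: "computable (S \<inter> {c. f c \<le> g c}) h" "computable (S \<inter> {c. \<not> f c \<le> g c}) h"
  shows "computable S h"
  unfolding computable_def
proof (intro allI impI)
  fix T fs G
  assume T: "T \<subseteq> S" and fs: "set input_fields \<subseteq> set fs"
    and k: "\<forall>U gs. U \<subseteq> T \<longrightarrow> set fs \<subseteq> set gs \<longrightarrow> stored U gs h \<longrightarrow> solvable U gs G"
  show "solvable T fs G"
  proof (rule computableD2[OF f g T fs])
    fix U gs
    assume U: "U \<subseteq> T" and gs: "set fs \<subseteq> set gs" and "stored U gs f" "stored U gs g"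
    then obtain i j where ij: "i < length gs" "j < length gs"
      "\<And>c. c \<in> U \<Longrightarrow> (gs ! i) c = f c \<and> (gs ! j) c = g c"
      unfolding stored_def by metis
    have "solvable (U \<inter> {c. f c \<le> g c}) gs G"
      by (rule computableD[OF h(1)]) (use T U fs gs k in auto)
    then obtain t where t: "\<forall>c\<in>U \<inter> {c. f c \<le> g c}.
        \<exists>P n. exec (rate c) t (map (\<lambda>f. f c) gs) = Some (P, n) \<and> G c P"
      unfolding solvable_def by blast
    have "solvable (U \<inter> {c. \<not> f c \<le> g c}) gs G"
      by (rule computableD[OF h(2)]) (use T U fs gs k in auto)
    then obtain t' where t': "\<forall>c\<in>U \<inter> {c. \<not> f c \<le> g c}.
        \<exists>P n. exec (rate c) t' (map (\<lambda>f. f c) gs) = Some (P, n) \<and> G c P"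
      unfolding solvable_def by blast
    show "solvable U gs G"
      unfolding solvable_def
    proof (intro exI[of _ "IfLe i j t t'"] ballI)
      fix c assume c: "c \<in> U"
      show "\<exists>P n. exec (rate c) (IfLe i j t t') (map (\<lambda>f. f c) gs) = Some (P, n) \<and> G c P"
        using ij c bspec[OF t, of c] bspec[OF t', of c] by (cases "f c \<le> g c") auto
    qed
  qed
qed

section \<open>Closure of computable functions under the instructions\<close>

lemma computable_const: "computable S (\<lambda>c. of_int z)"
  by (rule computable_instr[where ins = "\<lambda>i j. Lit z" and f = h_d and g = h_d])
     (auto intro!: computable_fields)

lemma computable_add: "computable S f \<Longrightarrow> computable S g \<Longrightarrow> computable S (\<lambda>c. f c + g c)"
  by (rule computable_instr[where ins = Add and f = f and g = g]) auto

lemma computable_diff: "computable S f \<Longrightarrow> computable S g \<Longrightarrow> computable S (\<lambda>c. f c - g c)"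
  by (rule computable_instr[where ins = Sub and f = f and g = g]) auto

lemma computable_mult: "computable S f \<Longrightarrow> computable S g \<Longrightarrow> computable S (\<lambda>c. f c * g c)"
  by (rule computable_instr[where ins = Mul and f = f and g = g]) auto

lemma computable_divide:
  "computable S f \<Longrightarrow> computable S g \<Longrightarrow> (\<And>c. c \<in> S \<Longrightarrow> g c \<noteq> 0) \<Longrightarrow> computable S (\<lambda>c. f c / g c)"
  by (rule computable_instr[where ins = Div and f = f and g = g]) auto

lemma computable_rate:
  "computable S f \<Longrightarrow> computable S g \<Longrightarrow> (\<And>c. c \<in> S \<Longrightarrow> f c \<ge> 0 \<and> g c \<ge> 0) \<Longrightarrow>
    computable S (\<lambda>c. rate c (f c, g c))"
  by (rule computable_instr[where ins = Rate and f = f and g = g]) auto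

lemma computable_0: "computable S (\<lambda>c. 0)"
  using computable_const[of S 0] by simp

lemma computable_1: "computable S (\<lambda>c. 1)"
  using computable_const[of S 1] by simp

lemma computable_minus: "computable S f \<Longrightarrow> computable S (\<lambda>c. - f c)"
  using computable_diff[OF computable_0] by simp

lemma computable_max: 
  assumes "computable S f" "computable S g"
  shows "computable S (\<lambda>c. max (f c) (g c))"
proof (rule computable_branch[OF assms])
  show "computable (S \<inter> {c. f c \<le> g c}) (\<lambda>c. max (f c) (g c))"
    by (rule computable_cong[OF computable_subset[OF assms(2)]]) auto
  show "computable (S \<inter> {c. \<not> f c \<le> g c}) (\<lambda>c. max (f c) (g c))"
    by (rule computable_cong[OF computable_subset[OF assms(1)]]) auto
qed

text \<open>Truth values are encoded as 0 and 1, so that comparing with 1 branches on them.\<close>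

definition decidable :: "d2d set \<Rightarrow> (d2d \<Rightarrow> bool) \<Rightarrow> bool" where
  "decidable S P \<longleftrightarrow> computable S (\<lambda>c. of_bool (P c))"

lemma computable_cases:
  assumes P: "decidable S P"
    and f: "computable (S \<inter> {c. P c}) f" "computable (S \<inter> {c. \<not> P c}) f"
  shows "computable S f"
proof (rule computable_branch[OF computable_1])
  show "computable S (\<lambda>c. of_bool (P c))" using P by (simp add: decidable_def)
qed (use f in simp_all)

lemma decidable_subset: "decidable S P \<Longrightarrow> T \<subseteq> S \<Longrightarrow> decidable T P"
  unfolding decidable_def by (rule computable_subset)

lemma decidable_const: "decidable S (\<lambda>c. b)"
  unfolding decidable_def by (cases b) (simp_all add: computable_0 computable_1)

lemma decidable_cong: "decidable S P \<Longrightarrow> (\<And>c. c \<in> S \<Longrightarrow> P c = Q c) \<Longrightarrow> decidable S Q"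
  unfolding decidable_def by (erule computable_cong) simp

lemma decidable_le:
  assumes "computable S f" "computable S g"
  shows "decidable S (\<lambda>c. f c \<le> g c)"
  unfolding decidable_def
  by (rule computable_branch[OF assms];
      rule decidable_cong[OF decidable_const, unfolded decidable_def]) auto

lemma decidable_if:
  assumes "decidable S P" "decidable (S \<inter> {c. P c}) Q" "decidable (S \<inter> {c. \<not> P c}) R"
  shows "decidable S (\<lambda>c. if P c then Q c else R c)"
  unfolding decidable_def
proof (rule computable_cases[OF assms(1)])
  show "computable (S \<inter> {c. P c}) (\<lambda>c. of_bool (if P c then Q c else R c))"
    by (rule computable_cong[OF assms(2)[unfolded decidable_def]]) auto
  show "computable (S \<inter> {c. \<not> P c}) (\<lambda>c. of_bool (if P c then Q c else R c))"
    by (rule computable_cong[OF assms(3)[unfolded decidable_def]]) auto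
qed

lemma decidable_not: "decidable S P \<Longrightarrow> decidable S (\<lambda>c. \<not> P c)"
  by (rule decidable_cong[OF decidable_if[OF _ decidable_const[of _ False] decidable_const[of _ True]]]) auto

text \<open>The second condition has to be decided only where the first holds, which lets the first
  guard divisions and oracle calls.\<close>

lemma decidable_conj: "decidable S P \<Longrightarrow> decidable (S \<inter> {c. P c}) Q \<Longrightarrow> decidable S (\<lambda>c. P c \<and> Q c)"
  by (rule decidable_cong[OF decidable_if[OF _ _ decidable_const[of _ False]]]) auto

lemma decidable_Ball:
  assumes "\<And>x. x \<in> set xs \<Longrightarrow> decidable S (P x)"
  shows "decidable S (\<lambda>c. \<forall>x\<in>set xs. P x c)"
  using assms
proof (induction xs)
  case (Cons x xs)
  then have "decidable S (\<lambda>c. P x c \<and> (\<forall>x\<in>set xs. P x c))"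
    by (intro decidable_conj decidable_subset[OF _ Int_lower1]) simp_all
  then show ?case by simp
qed (simp add: decidable_const)

lemma decidable_Bex:
  assumes "\<And>x. x \<in> set xs \<Longrightarrow> decidable S (P x)"
  shows "decidable S (\<lambda>c. \<exists>x\<in>set xs. P x c)"
  using decidable_not[OF decidable_Ball[of xs S "\<lambda>x c. \<not> P x c"]] assms decidable_not by simp

lemma decidable_eq:
  assumes "computable S f" "computable S g"
  shows "decidable S (\<lambda>c. f c = g c)"
proof -
  have "decidable S (\<lambda>c. f c \<le> g c \<and> g c \<le> f c)"
    by (intro decidable_conj decidable_le assms computable_subset[OF _ Int_lower1])
  then show ?thesis by (rule decidable_cong) auto
qed

text \<open>Closes the continuation-passing construction: start from the input memory and continue
  with \<open>Output\<close>.\<close>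

lemma ctree_for_triple:
  assumes f: "computable S f" and g: "computable S g" and h: "computable S h"
  shows "\<exists>t. \<forall>c\<in>S. \<exists>n. exec (rate c) t (inputs c) = Some ((f c, g c, h c), n)"
proof -
  have "solvable S input_fields (\<lambda>c P. P = (f c, g c, h c))"
  proof (rule computableD2[OF f g order_refl order_refl])
    fix U gs assume U: "U \<subseteq> S" and gs: "set input_fields \<subseteq> set gs" 
      and fg: "stored U gs f" "stored U gs g"
    show "solvable U gs (\<lambda>c P. P = (f c, g c, h c))"
    proof (rule computableD[OF h U gs])
      fix V hs assume V: "V \<subseteq> U" "set gs \<subseteq> set hs" "stored V hs h"
      have "stored V hs f" "stored V hs g"
        using stored_mono[OF fg(1) V(1,2)] stored_mono[OF fg(2) V(1,2)] .
      with V(3) obtain i j k where "i < length hs" "j < length hs" "k < length hs"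
        "\<forall>c\<in>V. (hs ! i) c = f c" "\<forall>c\<in>V. (hs ! j) c = g c" "\<forall>c\<in>V. (hs ! k) c = h c"
        unfolding stored_def by blast
      then show "solvable V hs (\<lambda>c P. P = (f c, g c, h c))"
        unfolding solvable_def by (intro exI[of _ "Output i j k"]) auto
    qed
  qed
  moreover have "map (\<lambda>f. f c) input_fields = inputs c" for c
    by (simp add: input_fields_def inputs_def)
  ultimately show ?thesis unfolding solvable_def by auto
qed

section \<open>Selecting the best of finitely many points\<close>

type_synonym partial_point = "(d2d \<Rightarrow> bool) \<times> (d2d \<Rightarrow> real) \<times> (d2d \<Rightarrow> real)"

text \<open>The guard of an entry says on which inputs its coordinates count; only valid entries
  compete.\<close>

definition is_best :: "partial_point set \<Rightarrow> d2d \<Rightarrow> real \<times> real \<Rightarrow> bool" where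
  "is_best L c p \<longleftrightarrow>
     (\<exists>(P, x, y) \<in> L. P c \<and> p = (x c, y c)) \<and>
     (\<forall>(P, x, y) \<in> L. P c \<longrightarrow> rate c (x c, y c) \<le> rate c p)"

lemma is_best_insert:
  "is_best (insert (P, x, y) L) c p \<longleftrightarrow>
     (P c \<and> p = (x c, y c) \<or> (\<exists>(P, x, y) \<in> L. P c \<and> p = (x c, y c))) \<and>
     (P c \<longrightarrow> rate c (x c, y c) \<le> rate c p) \<and>
     (\<forall>(P, x, y) \<in> L. P c \<longrightarrow> rate c (x c, y c) \<le> rate c p)"
  unfolding is_best_def by auto

text \<open>Induction on the list, comparing its head with the best valid entry of the tail.
  Nonnegative coordinates at valid entries make the oracle calls legal.\<close>

lemma computable_best:
  assumes "\<And>P x y. (P, x, y) \<in> set L \<Longrightarrow> decidable S P \<and>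
      computable (S \<inter> {c. P c}) x \<and> computable (S \<inter> {c. P c}) y \<and>
      (\<forall>c\<in>S. P c \<longrightarrow> x c \<ge> 0 \<and> y c \<ge> 0)"
    and "\<And>c. c \<in> S \<Longrightarrow> \<exists>q \<in> set L. fst q c"
  shows "\<exists>x y. computable S x \<and> computable S y \<and> (\<forall>c\<in>S. is_best (set L) c (x c, y c))"
  using assms
proof (induction L arbitrary: S)
  case Nil
  then have "S = {}" by auto
  then show ?case using computable_0 by auto
next
  case (Cons q L)
  obtain P0 x0 y0 where q: "q = (P0, x0, y0)" by (cases q)
  have q': "decidable S P0" "computable (S \<inter> {c. P0 c}) x0" "computable (S \<inter> {c. P0 c}) y0"
    "\<And>c. c \<in> S \<Longrightarrow> P0 c \<Longrightarrow> x0 c \<ge> 0 \<and> y0 c \<ge> 0"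
    using Cons.prems(1)[of P0 x0 y0] q by simp_all
  have L: "decidable S P" "computable (S \<inter> {c. P c}) x" "computable (S \<inter> {c. P c}) y"
    "\<forall>c\<in>S. P c \<longrightarrow> x c \<ge> 0 \<and> y c \<ge> 0" if "(P, x, y) \<in> set L" for P x y
    using Cons.prems(1)[of P x y] that by simp_all
  \<comment> \<open>\<open>V\<close> says that the tail has a valid entry; the induction hypothesis
    applies to exactly those inputs.\<close>
  define V where "V c \<longleftrightarrow> (\<exists>p\<in>set L. fst p c)" for c
  have V: "decidable S V"
    unfolding V_def by (rule decidable_Bex) (metis L(1) prod.collapse)
  define T where "T = S \<inter> {c. V c}"
  have TS: "T \<subseteq> S" by (auto simp: T_def)
  have "\<exists>x y. computable T x \<and> computable T y \<and> (\<forall>c\<in>T. is_best (set L) c (x c, y c))"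
  proof (rule Cons.IH)
    show "decidable T P \<and> computable (T \<inter> {c. P c}) x \<and> computable (T \<inter> {c. P c}) y \<and>
      (\<forall>c\<in>T. P c \<longrightarrow> x c \<ge> 0 \<and> y c \<ge> 0)" if "(P, x, y) \<in> set L" for P x y
    proof -
      have "T \<inter> {c. P c} \<subseteq> S \<inter> {c. P c}" using TS by blast
      with L[OF that] show ?thesis
        using decidable_subset[OF _ TS] computable_subset TS by (meson subsetD)
    qed
    show "\<exists>q \<in> set L. fst q c" if "c \<in> T" for c
      using that by (auto simp: T_def V_def)
  qed
  then obtain x1 y1 where 1: "computable T x1" "computable T y1"
    and best: "\<forall>c\<in>T. is_best (set L) c (x1 c, y1 c)"
    by (elim exE conjE) (rule that)
  have nn1: "x1 c \<ge> 0 \<and> y1 c \<ge> 0" if c: "c \<in> T" for c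
  proof -
    obtain P x y where "(P, x, y) \<in> set L" "P c" "x1 c = x c" "y1 c = y c"
      using bspec[OF best c] unfolding is_best_def by auto
    with L(4)[of P x y] TS c show ?thesis by auto
  qed
  \<comment> \<open>\<open>W\<close> says that the tail wins. The nested conditional restricts the
    rate comparison to inputs where both points are defined.\<close>
  define W where "W c \<longleftrightarrow> V c \<and> (if P0 c then rate c (x0 c, y0 c) \<le> rate c (x1 c, y1 c) else True)" for c
  have W: "decidable S W"
    unfolding W_def
  proof (intro decidable_conj V decidable_if decidable_const decidable_le computable_rate)
    show "decidable (S \<inter> {c. V c}) P0"
      using q'(1) by (rule decidable_subset) simp
    show "computable (S \<inter> {c. V c} \<inter> {c. P0 c}) x0" "computable (S \<inter> {c. V c} \<inter> {c. P0 c}) y0"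
      by (rule computable_subset[OF q'(2)] computable_subset[OF q'(3)]; blast)+
    show "computable (S \<inter> {c. V c} \<inter> {c. P0 c}) x1" "computable (S \<inter> {c. V c} \<inter> {c. P0 c}) y1"
      by (rule computable_subset[OF 1(1)] computable_subset[OF 1(2)]; auto simp: T_def)+
  qed (use q'(4) nn1 in \<open>simp_all add: T_def\<close>)
  \<comment> \<open>Where the head is chosen it is valid: otherwise some tail entry is valid and
    \<open>W\<close> holds.\<close>
  have P0: "P0 c" if "c \<in> S" "\<not> W c" for c
  proof (rule ccontr)
    assume "\<not> P0 c"
    moreover from this have "V c" using Cons.prems(2)[OF that(1)] by (simp add: V_def q)
    ultimately show False using that by (simp add: W_def)
  qed
  have "computable S (\<lambda>c. if W c then f1 c else f0 c)"
    if f: "computable T f1" "computable (S \<inter> {c. P0 c}) f0" for f1 f0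
  proof (rule computable_cases[OF W])
    show "computable (S \<inter> {c. W c}) (\<lambda>c. if W c then f1 c else f0 c)"
      by (rule computable_cong[OF computable_subset[OF f(1)]]) (simp_all add: T_def W_def subset_iff)
    show "computable (S \<inter> {c. \<not> W c}) (\<lambda>c. if W c then f1 c else f0 c)"
      by (rule computable_cong[OF computable_subset[OF f(2)]]) (simp_all add: P0 subset_iff)
  qed
  note computable_if = this
  define x y where "x c = (if W c then x1 c else x0 c)" and "y c = (if W c then y1 c else y0 c)" for c
  have "computable S x" "computable S y"
    unfolding x_def y_def by (rule computable_if; fact)+
  moreover have "is_best (set (q # L)) c (x c, y c)" if c: "c \<in> S" for c
  proof (cases "V c")
    case True
    then have "c \<in> T" using c by (simp add: T_def)
    with best have b: "\<exists>(P, x, y) \<in> set L. P c \<and> (x1 c, y1 c) = (x c, y c)"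
      and le: "\<forall>(P, x, y) \<in> set L. P c \<longrightarrow> rate c (x c, y c) \<le> rate c (x1 c, y1 c)"
      unfolding is_best_def by blast+
    show ?thesis
    proof (cases "W c")
      case True
      then show ?thesis
        unfolding list.set q is_best_insert using b le by (simp add: x_def y_def W_def)
    next
      case False
      then have "rate c (x1 c, y1 c) \<le> rate c (x0 c, y0 c)"
        using \<open>V c\<close> by (simp add: W_def split: if_splits)
      with le have "\<forall>(P, x, y) \<in> set L. P c \<longrightarrow> rate c (x c, y c) \<le> rate c (x0 c, y0 c)"
        by fastforce
      then show ?thesis
        unfolding list.set q is_best_insert using False P0[OF c False] by (simp add: x_def y_def)
    qed
  next
    case False
    then have "\<not> W c" "\<forall>(P, x, y) \<in> set L. \<not> P c" by (auto simp: W_def V_def)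
    with P0[OF c] show ?thesis
      unfolding list.set q is_best_insert x_def y_def by auto
  qed
  ultimately show ?case by blast
qed

section \<open>Maximizing the rate\<close>

text \<open>Cramer's rule for the two bounding lines, meaningful where the determinant is
  nonzero.\<close>

definition crossing :: "halfplane \<Rightarrow> halfplane \<Rightarrow> (d2d \<Rightarrow> real) \<times> (d2d \<Rightarrow> real)" where
  "crossing H K =
     (\<lambda>c. (rhs H c * fst (snd K) c - rhs K c * fst (snd H) c) / cross_coeffs c H K,
      \<lambda>c. (fst H c * rhs K c - fst K c * rhs H c) / cross_coeffs c H K)"

definition crossing_in_projD :: "decoding_order \<Rightarrow> halfplane \<Rightarrow> halfplane \<Rightarrow> d2d \<Rightarrow> bool" where
  "crossing_in_projD ord H K c \<longleftrightarrow> cross_coeffs c H K \<noteq> 0 \<and>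
     (\<forall>L\<in>set (upper @ lower ord). lhs L c (fst (crossing H K) c, snd (crossing H K) c) \<le> rhs L c)"

definition crossings :: "decoding_order \<Rightarrow> partial_point list" where
  "crossings ord = [(crossing_in_projD ord H K, crossing H K). H \<leftarrow> upper, K \<leftarrow> upper @ lower ord]"

lemma crossingsE:
  assumes "(P, x, y) \<in> set (crossings ord)"
  obtains H K where "H \<in> set upper" "K \<in> set (upper @ lower ord)"
    "P = crossing_in_projD ord H K" "x = fst (crossing H K)" "y = snd (crossing H K)"
proof -
  have "\<exists>H\<in>set upper. \<exists>K\<in>set (upper @ lower ord). (P, x, y) = (crossing_in_projD ord H K, crossing H K)"
    using assms unfolding crossings_def by (simp only: set_concat set_map image_image UN_iff image_iff)
  then obtain H K where "H \<in> set upper" "K \<in> set (upper @ lower ord)"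
    "(P, x, y) = (crossing_in_projD ord H K, crossing H K)"
    by blast
  then show ?thesis by (intro that[of H K]) (simp_all add: prod_eq_iff)
qed

lemma crossing_unique:
  assumes "cross_coeffs c H K \<noteq> 0" "lhs H c p = rhs H c" "lhs K c p = rhs K c"
  shows "p = (fst (crossing H K) c, snd (crossing H K) c)"
proof -
  have "fst p * cross_coeffs c H K = rhs H c * fst (snd K) c - rhs K c * fst (snd H) c"
    "snd p * cross_coeffs c H K = fst H c * rhs K c - fst K c * rhs H c"
    unfolding assms(2,3)[symmetric] by (simp_all add: cross_coeffs_def lhs_def algebra_simps)
  then show ?thesis
    using assms(1) by (intro prod_eqI) (simp_all add: crossing_def nonzero_eq_divide_eq)
qed

lemma face_endpoint_crossing:
  assumes c: "admissible c" and p: "p \<in> face_endpoints ord c"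
  shows "\<exists>(P, x, y) \<in> set (crossings ord). P c \<and> p = (x c, y c)"
proof -
  obtain H where H: "H \<in> set upper" "p \<in> endpoints (face ord c H)"
    using p by (auto simp: face_endpoints_def)
  then have "p \<in> face ord c H" using endpoints_subset by blast
  then have D: "\<forall>L\<in>set (upper @ lower ord). lhs L c p \<le> rhs L c" and pH: "lhs H c p = rhs H c"
    unfolding face_def projD_eq[OF c] by simp_all
  obtain K where K: "K \<in> set (upper @ lower ord)" "cross_coeffs c H K \<noteq> 0" "lhs K c p = rhs K c"
    using endpoint_on_crossing_line[OF c H] by blast
  have eq: "p = (fst (crossing H K) c, snd (crossing H K) c)"
    by (rule crossing_unique[OF K(2) pH K(3)])
  have "crossing_in_projD ord H K c"
    using D K(2) unfolding crossing_in_projD_def eq by blast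
  moreover have "(crossing_in_projD ord H K, crossing H K) \<in> set (crossings ord)"
    unfolding crossings_def using H(1) K(1) by auto
  ultimately show ?thesis using eq by (intro bexI) (auto simp: split_beta)
qed

lemma computable_coeffs:
  assumes "H \<in> set (upper @ lower ord)"
  shows "computable S (fst H)" "computable S (fst (snd H))" "computable S (rhs H)"
proof -
  have m: "computable S (fst m) \<and> computable S (snd m)" if "m \<in> set (margins ord)" for m
    using that by (cases ord) (auto intro!: computable_minus computable_0 computable_fields)
  have "computable S (fst K) \<and> computable S (fst (snd K)) \<and> computable S (rhs K)"
    if "K \<in> set (lower_of n)" "n \<in> set (margins ord)" for K n
    using that(1) m[OF that(2)]
    by (auto simp: lower_of_def rhs_def split_beta
        intro!: computable_minus computable_0 computable_diff computable_mult computable_fields)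
  moreover have "computable S (fst K) \<and> computable S (fst (snd K)) \<and> computable S (rhs K)"
    if "K \<in> set upper" for K
    using that by (auto simp: upper_def rhs_def intro!: computable_0 computable_1 computable_mult computable_fields)
  moreover consider "H \<in> set upper" | n where "H \<in> set (lower_of n)" "n \<in> set (margins ord)"
    using assms unfolding lower_def set_append set_concat set_map by blast
  ultimately show "computable S (fst H)" "computable S (fst (snd H))" "computable S (rhs H)"
    by metis+
qed

lemma computable_crossing:
  assumes "H \<in> set upper" "K \<in> set (upper @ lower ord)"
  shows "computable (S \<inter> {c. cross_coeffs c H K \<noteq> 0}) (fst (crossing H K))"
    "computable (S \<inter> {c. cross_coeffs c H K \<noteq> 0}) (snd (crossing H K))"
    and "computable S (\<lambda>c. cross_coeffs c H K)"
proof -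
  have H: "H \<in> set (upper @ lower ord)" using assms(1) by simp
  note coeffs = computable_coeffs[OF H] computable_coeffs[OF assms(2)]
  show det: "computable S (\<lambda>c. cross_coeffs c H K)" for S
    unfolding cross_coeffs_def by (intro computable_diff computable_mult coeffs)
  show "computable (S \<inter> {c. cross_coeffs c H K \<noteq> 0}) (fst (crossing H K))"
    "computable (S \<inter> {c. cross_coeffs c H K \<noteq> 0}) (snd (crossing H K))"
    unfolding crossing_def fst_conv snd_conv
    by (intro computable_divide computable_diff computable_mult coeffs det; simp)+
qed

text \<open>The determinant is tested first; the coordinates, which divide by it, are computed only
  where it is nonzero.\<close>

lemma decidable_crossing_in_projD:
  assumes "H \<in> set upper" "K \<in> set (upper @ lower ord)"
  shows "decidable S (crossing_in_projD ord H K)"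
  unfolding crossing_in_projD_def lhs_def fst_conv snd_conv
  by (intro decidable_conj decidable_not decidable_eq decidable_Ball decidable_le computable_add
      computable_mult computable_0 computable_crossing[OF assms] computable_coeffs[where ord = ord])

lemma computable_Pu_min:
  assumes "computable S x" "computable S y" "\<And>c. c \<in> S \<Longrightarrow> admissible c"
  shows "computable S (\<lambda>c. Pu_min c (x c) (y c))"
proof -
  have "h_d1u c \<noteq> 0" "h_d2u c \<noteq> 0" if "c \<in> S" for c
    using assms(3)[OF that] by (auto simp: admissible_def)
  then have "computable S (\<lambda>c. max ((y c * h_d c + x c * eta1 c) / h_d1u c)
      (max ((x c * h_d c + y c * eta2 c) / h_d2u c) (Pum c)))"
    by (intro computable_max computable_divide computable_add computable_mult assms(1,2) computable_fields)
  then show ?thesis by (simp add: Pu_min_def)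
qed

text \<open>The objective ignores the power of \<open>u\<close>, so a maximum over the projection
  lifts by completing the pair with \<open>Pu_min\<close>.\<close>

lemma objective_arg_max:
  assumes c: "admissible c" and p: "(x, y) \<in> projD ord c"
    and max: "\<And>q. q \<in> projD ord c \<Longrightarrow> rate c q \<le> rate c (x, y)"
  shows "is_arg_max (objective c) (\<lambda>z. z \<in> feasible ord c) (x, y, Pu_min c x y)"
  unfolding is_arg_max_linorder
proof (intro conjI allI impI)
  show "(x, y, Pu_min c x y) \<in> feasible ord c" by (rule Pu_min_least(1)[OF c p])
  fix z assume z: "z \<in> feasible ord c"
  obtain x' y' u where xyu: "z = (x', y', u)" by (cases z)
  have "(x', y') \<in> projD ord c" unfolding projD_def using z xyu by force
  then show "objective c z \<le> objective c (x, y, Pu_min c x y)"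
    using max by (simp add: objective_def xyu)
qed

text \<open>The tree takes all crossings inside the polygon without singling out the endpoints. All
  of them are points of \<open>projD\<close> and every face endpoint is among them, so the best one
  is a global maximum.\<close>

lemma ctree_arg_max:
  "\<exists>t. \<forall>c. admissible c \<and> feasible ord c \<noteq> {} \<longrightarrow>
     (\<exists>P n. exec (rate c) t (inputs c) = Some (P, n) \<and>
        is_arg_max (objective c) (\<lambda>x. x \<in> feasible ord c) P)"
proof -
  define S where "S = {c. admissible c \<and> feasible ord c \<noteq> {}}"
  have adm: "admissible c" if "c \<in> S" for c using that by (simp add: S_def)
  have in_projD: "(x c, y c) \<in> projD ord c" if "(P, x, y) \<in> set (crossings ord)" "P c" "c \<in> S" for P x y c
    using crossingsE[OF that(1)] that(2) unfolding projD_eq[OF adm[OF that(3)]] crossing_in_projD_def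
    by blast
  have above: "\<exists>p\<in>face_endpoints ord c. rate c q \<le> rate c p" if "c \<in> S" "q \<in> projD ord c" for c q
    using endpoint_above adm that by blast
  have "\<exists>x y. computable S x \<and> computable S y \<and> (\<forall>c\<in>S. is_best (set (crossings ord)) c (x c, y c))"
  proof (rule computable_best)
    fix P x y assume Pxy: "(P, x, y) \<in> set (crossings ord)"
    then obtain H K where HK: "H \<in> set upper" "K \<in> set (upper @ lower ord)"
      "P = crossing_in_projD ord H K" "x = fst (crossing H K)" "y = snd (crossing H K)"
      by (rule crossingsE)
    have sub: "S \<inter> {c. P c} \<subseteq> S \<inter> {c. cross_coeffs c H K \<noteq> 0}"
      by (auto simp: HK crossing_in_projD_def)
    have "0 \<le> x c \<and> 0 \<le> y c" if "c \<in> S" "P c" for c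
      using projD_pos[OF adm in_projD[OF Pxy]] that by (simp add: less_imp_le)
    then show "decidable S P \<and> computable (S \<inter> {c. P c}) x \<and> computable (S \<inter> {c. P c}) y \<and>
        (\<forall>c\<in>S. P c \<longrightarrow> x c \<ge> 0 \<and> y c \<ge> 0)"
      using decidable_crossing_in_projD[OF HK(1,2)] computable_subset[OF computable_crossing(1)[OF HK(1,2)] sub]
        computable_subset[OF computable_crossing(2)[OF HK(1,2)] sub] HK by simp
  next
    fix c assume c: "c \<in> S"
    then have "projD ord c \<noteq> {}" by (simp add: S_def projD_def)
    then obtain q where "q \<in> projD ord c" by blast
    then obtain p where "p \<in> face_endpoints ord c" using above[OF c] by blast
    then show "\<exists>q\<in>set (crossings ord). fst q c"
      using face_endpoint_crossing[OF adm[OF c], of p ord] by (auto simp: Bex_def)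
  qed
  then obtain x y where xy: "computable S x" "computable S y"
    and best: "\<forall>c\<in>S. is_best (set (crossings ord)) c (x c, y c)"
    by (elim exE conjE) (rule that)
  obtain t where t: "\<forall>c\<in>S. \<exists>n. exec (rate c) t (inputs c) = Some ((x c, y c, Pu_min c (x c) (y c)), n)"
    using ctree_for_triple[OF xy computable_Pu_min[OF xy adm]] by blast
  have "is_arg_max (objective c) (\<lambda>x. x \<in> feasible ord c) (x c, y c, Pu_min c (x c) (y c))" if c: "c \<in> S" for c
  proof (rule objective_arg_max[OF adm[OF c]])
    have b: "\<exists>(P, x', y') \<in> set (crossings ord). P c \<and> (x c, y c) = (x' c, y' c)"
      "\<forall>(P, x', y') \<in> set (crossings ord). P c \<longrightarrow> rate c (x' c, y' c) \<le> rate c (x c, y c)"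
      using best c unfolding is_best_def by blast+
    show "(x c, y c) \<in> projD ord c" using b(1) in_projD c by auto
    fix q assume "q \<in> projD ord c"
    then obtain p where p: "p \<in> face_endpoints ord c" "rate c q \<le> rate c p" using above[OF c] by blast
    then have "rate c p \<le> rate c (x c, y c)"
      using face_endpoint_crossing[OF adm[OF c] p(1)] b(2) by fastforce
    with p(2) show "rate c q \<le> rate c (x c, y c)" by simp
  qed
  with t show ?thesis unfolding S_def by blast
qed

section \<open>The candidate list and the bounds of the theorem\<close>

lemma card_sol_points:
  assumes c: "admissible c"
  shows "finite (sol1_points ord c) \<and> card (sol1_points ord c) \<le> 1"
    "finite (sol1'_points ord c) \<and> card (sol1'_points ord c) \<le> 1"
proof -
  have pos: "h_d c > 0" "eta2 c > 0" "h_d1u c > 0" "h_d2u c > 0"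
    using c by (auto simp: admissible_def)
  show "finite (sol1_points ord c) \<and> card (sol1_points ord c) \<le> 1"
  proof (rule card_le_1_if_unique)
    fix p q assume pq: "p \<in> sol1_points ord c" "q \<in> sol1_points ord c"
    \<comment> \<open>The formula fixes the first coordinate, and the equation of the oblique line
      then fixes the second because \<open>h_d c > 0\<close>.\<close>
    then have eq: "fst p = fst q" by (auto simp: sol1_points_def is_sol_def)
    have "(snd r * h_d c + fst r * eta1 c) / h_d1u c = PuM c" if "r \<in> {p, q}" for r
      using pq that by (auto simp: sol1_points_def EU2_def)
    then have "(snd p * h_d c + fst p * eta1 c) / h_d1u c = (snd q * h_d c + fst q * eta1 c) / h_d1u c" by simp
    then show "p = q" using pos eq by (intro prod_eqI) simp_all
  qed
  show "finite (sol1'_points ord c) \<and> card (sol1'_points ord c) \<le> 1"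
  proof (rule card_le_1_if_unique)
    fix p q assume pq: "p \<in> sol1'_points ord c" "q \<in> sol1'_points ord c"
    then have eq: "fst p = fst q" by (auto simp: sol1'_points_def is_sol_def)
    have "(fst r * h_d c + snd r * eta2 c) / h_d2u c = PuM c" if "r \<in> {p, q}" for r
      using pq that by (auto simp: sol1'_points_def EU4_def)
    then have "(fst p * h_d c + snd p * eta2 c) / h_d2u c = (fst q * h_d c + snd q * eta2 c) / h_d2u c" by simp
    then show "p = q" using pos eq by (intro prod_eqI) simp_all
  qed
qed

lemma faces_image: "admissible c \<Longrightarrow> {E1 ord c, E2 ord c, EU2 ord c, EU4 ord c} = face ord c ` set upper"
  by (simp add: faces_eq upper_def numeral_eq_Suc)

lemma candidates_eq:
  "admissible c \<Longrightarrow> candidates ord c = face_endpoints ord c \<union> sol1_points ord c \<union> sol1'_points ord c"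
  by (auto simp: candidates_def face_endpoints_def faces_eq upper_def numeral_eq_Suc)

text \<open>Five endpoints and one stationary point on each oblique face.\<close>

lemma card_candidates:
  assumes c: "admissible c"
  shows "finite (candidates ord c)" "card (candidates ord c) \<le> 7"
proof -
  show "finite (candidates ord c)"
    using card_face_endpoints[OF c] card_sol_points[OF c] by (simp add: candidates_eq[OF c])
  have "card (candidates ord c) \<le>
      card (face_endpoints ord c) + card (sol1_points ord c) + card (sol1'_points ord c)"
    unfolding candidates_eq[OF c] by (meson add_le_mono card_Un_le order_refl order_trans)
  then show "card (candidates ord c) \<le> 7"
    using card_face_endpoints(2)[OF c, of ord] card_sol_points[OF c, of ord] by linarith
qed

lemma candidate_arg_max:
  assumes c: "admissible c" and ne: "feasible ord c \<noteq> {}"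
  shows "\<exists>(P1, P2) \<in> candidates ord c.
     is_arg_max (objective c) (\<lambda>x. x \<in> feasible ord c) (P1, P2, Pu_min c P1 P2)"
proof -
  have "projD ord c \<noteq> {}" using ne by (simp add: projD_def)
  then obtain q where "q \<in> projD ord c" by blast
  then have ne': "face_endpoints ord c \<noteq> {}" using endpoint_above[OF c] by blast
  have "Max (rate c ` face_endpoints ord c) \<in> rate c ` face_endpoints ord c"
    by (rule Max_in) (use card_face_endpoints(1)[OF c] ne' in auto)
  then obtain p where p: "p \<in> face_endpoints ord c" "Max (rate c ` face_endpoints ord c) = rate c p"
    by blast
  then have max: "rate c q \<le> rate c p" if "q \<in> face_endpoints ord c" for q
    using that card_face_endpoints(1)[OF c] by (metis Max_ge finite_imageI imageI)
  obtain x y where xy: "p = (x, y)" by (cases p)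
  have "is_arg_max (objective c) (\<lambda>x. x \<in> feasible ord c) (x, y, Pu_min c x y)"
  proof (rule objective_arg_max[OF c])
    show "(x, y) \<in> projD ord c"
      using p(1) endpoints_subset unfolding xy face_endpoints_def face_def by blast
    show "rate c q \<le> rate c (x, y)" if "q \<in> projD ord c" for q
      using endpoint_above[OF c that] max unfolding xy by (meson order_trans)
  qed
  then show ?thesis using p(1) by (auto simp: candidates_eq[OF c] xy)
qed

text \<open>The arbitrary set \<open>T\<close> lets one statement serve all four faces: it is empty
  for \<open>E1\<close> and \<open>E2\<close> and holds the stationary points for \<open>EU2\<close>
  and \<open>EU4\<close>.\<close>

lemma nonempty_face:
  assumes c: "admissible c" and S: "S \<in> {E1 ord c, E2 ord c, EU2 ord c, EU4 ord c}" and ne: "S \<noteq> {}"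
  shows "is_segment S" "\<exists>p \<in> endpoints S \<union> T. is_arg_max (rate c) (\<lambda>q. q \<in> S) p"
proof -
  obtain H where H: "H \<in> set upper" "S = face ord c H"
    using S unfolding faces_image[OF c] by blast
  show "is_segment S"
    using face_segment[OF c H(1)] ne unfolding is_segment_def H(2) by metis
  show "\<exists>p \<in> endpoints S \<union> T. is_arg_max (rate c) (\<lambda>q. q \<in> S) p"
    using face_arg_max_endpoint[OF c H(1)] ne unfolding H(2) by blast
qed

text \<open>There is one tree per decoding order; the larger of the two depths bounds every
  run.\<close>

lemma bounded_ctree_arg_max:
  "\<exists>N. \<forall>ord. \<exists>t. \<forall>c. admissible c \<and> feasible ord c \<noteq> {} \<longrightarrow>
      (\<exists>P n. exec (rate c) t (inputs c) = Some (P, n) \<and> n \<le> N \<and>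
         is_arg_max (objective c) (\<lambda>x. x \<in> feasible ord c) P)"
proof -
  obtain t where t: "\<And>ord c. admissible c \<and> feasible ord c \<noteq> {} \<Longrightarrow>
      \<exists>P n. exec (rate c) (t ord) (inputs c) = Some (P, n) \<and>
        is_arg_max (objective c) (\<lambda>x. x \<in> feasible ord c) P"
    using ctree_arg_max by metis
  let ?N = "max (depth (t First)) (depth (t Second))"
  have N: "depth (t ord) \<le> ?N" for ord by (cases ord) auto
  show ?thesis
  proof (intro exI[of _ ?N] allI)
    fix ord
    show "\<exists>t. \<forall>c. admissible c \<and> feasible ord c \<noteq> {} \<longrightarrow>
        (\<exists>P n. exec (rate c) t (inputs c) = Some (P, n) \<and> n \<le> ?N \<and>
          is_arg_max (objective c) (\<lambda>x. x \<in> feasible ord c) P)"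
    proof (intro exI[of _ "t ord"] allI impI)
      fix c assume c: "admissible c \<and> feasible ord c \<noteq> {}"
      obtain P n where P: "exec (rate c) (t ord) (inputs c) = Some (P, n)"
        "is_arg_max (objective c) (\<lambda>x. x \<in> feasible ord c) P"
        using t[OF c] by (elim exE conjE) (rule that)
      with order_trans[OF exec_cost_le_depth[OF P(1)] N[of ord]]
      show "\<exists>P n. exec (rate c) (t ord) (inputs c) = Some (P, n) \<and> n \<le> ?N \<and>
          is_arg_max (objective c) (\<lambda>x. x \<in> feasible ord c) P"
        by (intro exI conjI)
    qed
  qed
qed

theorem mainTheorem5:
  "(\<forall>ord c. admissible c \<and> feasible ord c \<noteq> {} \<longrightarrow>
      (\<forall>S \<in> {E1 ord c, E2 ord c, EU2 ord c, EU4 ord c}. S \<noteq> {} \<longrightarrow> is_segment S) \<and>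
      (\<forall>S \<in> {E1 ord c, E2 ord c}. S \<noteq> {} \<longrightarrow>
         (\<exists>p \<in> endpoints S. is_arg_max (rate c) (\<lambda>q. q \<in> S) p)) \<and>
      (EU2 ord c \<noteq> {} \<longrightarrow>
         (\<exists>p \<in> endpoints (EU2 ord c) \<union> sol1_points ord c.
            is_arg_max (rate c) (\<lambda>q. q \<in> EU2 ord c) p)) \<and>
      (EU4 ord c \<noteq> {} \<longrightarrow>
         (\<exists>p \<in> endpoints (EU4 ord c) \<union> sol1'_points ord c.
            is_arg_max (rate c) (\<lambda>q. q \<in> EU4 ord c) p)) \<and>
      (\<exists>(P1, P2) \<in> candidates ord c.
         is_arg_max (objective c) (\<lambda>x. x \<in> feasible ord c) (P1, P2, Pu_min c P1 P2)) \<and>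
      finite (candidates ord c) \<and> card (candidates ord c) \<le> 7)
   \<and>
   (\<exists>N. \<forall>ord. \<exists>t. \<forall>c. admissible c \<and> feasible ord c \<noteq> {} \<longrightarrow>
      (\<exists>P n. exec (rate c) t (inputs c) = Some (P, n) \<and> n \<le> N \<and>
         is_arg_max (objective c) (\<lambda>x. x \<in> feasible ord c) P))"
proof (rule conjI[OF _ bounded_ctree_arg_max], rule allI, rule allI, rule impI, erule conjE,
    intro conjI ballI impI)
  fix ord c assume c: "admissible c" and ne: "feasible ord c \<noteq> {}"
  show "is_segment S" if "S \<in> {E1 ord c, E2 ord c, EU2 ord c, EU4 ord c}" "S \<noteq> {}" for S
    using nonempty_face(1)[OF c that] .
  show "\<exists>p \<in> endpoints S. is_arg_max (rate c) (\<lambda>q. q \<in> S) p"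
    if "S \<in> {E1 ord c, E2 ord c}" "S \<noteq> {}" for S
    using nonempty_face(2)[OF c _ that(2), of ord "{}"] that(1) by auto
  show "\<exists>p \<in> endpoints (EU2 ord c) \<union> sol1_points ord c. is_arg_max (rate c) (\<lambda>q. q \<in> EU2 ord c) p"
    if "EU2 ord c \<noteq> {}"
    by (rule nonempty_face(2)[OF c _ that, of ord]) simp
  show "\<exists>p \<in> endpoints (EU4 ord c) \<union> sol1'_points ord c. is_arg_max (rate c) (\<lambda>q. q \<in> EU4 ord c) p"
    if "EU4 ord c \<noteq> {}"
    by (rule nonempty_face(2)[OF c _ that, of ord]) simp
  show "\<exists>(P1, P2) \<in> candidates ord c.
      is_arg_max (objective c) (\<lambda>x. x \<in> feasible ord c) (P1, P2, Pu_min c P1 P2)"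
    by (rule candidate_arg_max[OF c ne])
  show "finite (candidates ord c)" "card (candidates ord c) \<le> 7"
    by (rule card_candidates[OF c])+
qed

end
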